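(* Let $\tau:\mathbb{U}\to\Omega$, $\tau(z)=\frac{az+b}{cz+d}$, be a linear fractional Riemann map and let $\lambda,r\in\mathbb{C}$ with $\lambda\neq0$. (1) Suppose that $|c|^{2}=|d|^{2}$, that $$\Phi(w)=\overline{\lambda}^{-1}w+r\quad\text{and}\quad\Phi_{\star}(w)=\lambda w+\frac{(\lambda-1)(|a|^{2}-|b|^{2})+\lambda\overline{r}(b\overline{d}-a\overline{c})}{\overline{b}d-\overline{a}c}$$ are self-maps of $\Omega$, and that $C_{\Phi}$ is bounded on $H^{2}(\Omega)$. Then $C_{\Phi}$ is normal if and only if $$(\lambda-1)(1-\overline{\lambda})(|a|^{2}-|b|^{2})=2\,\mathrm{Re}\big(\lambda\overline{r}(b\overline{d}-a\overline{c})(\overline{\lambda}-1)\big).$$ (2) Suppose that $|c|^{2}\neq|d|^{2}$, that $$\Phi(w)=rw+\frac{(r-1)(b\overline{d}-a\overline{c})}{|c|^{2}-|d|^{2}}\quad\text{and}\quad\Phi_{\star}(w)=\overline{r}w+\frac{(\overline{r}-1)(b\overline{d}-a\overline{c})}{|c|^{2}-|d|^{2}}$$ are self-maps of $\Omega$, and that $C_{\Phi}$ is bounded on $H^{2}(\Omega)$. Then $C_{\Phi}$ is normal.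
   Context: $\mathbb{U}$ is the open unit disc and $\Omega$ is an open simply connected proper subset of $\mathbb{C}$. A Riemann map $\tau:\mathbb{U}\to\Omega$ is a biholomorphic map of $\mathbb{U}$ onto $\Omega$; it is a linear fractional Riemann map if $\tau(z)=\frac{az+b}{cz+d}$ with $a,b,c,d\in\mathbb{C}$, $ad-bc\neq0$. The Hardy-Smirnov space $H^{2}(\Omega)$ is the set of analytic $f:\Omega\to\mathbb{C}$ with $\|f\|^{2}=\sup_{0<r<1}\frac{1}{2\pi}\int_{\Gamma_r}|f(w)|^{2}|dw|<\infty$, where $\Gamma_r=\tau(\{|z|=r\})$; the norm is the one induced by the given $\tau$. Fix an analytic branch of $(\tau')^{1/2}$ on $\mathbb{U}$. The map $Vf=(f\circ\tau)(\tau')^{1/2}$ is an isometric isomorphism from $H^2(\Omega)$ onto the classical Hardy space $H^2(\mathbb{U})$, and $H^{2}(\Omega)$ is a Hilbert space with inner product $\langle f,g\rangle=\langle Vf,Vg\rangle_{2}$, where $\langle\cdot,\cdot\rangle_2$ is the inner product of $H^2(\mathbb{U})$, $\langle F,G\rangle_2=\sum_{n\ge0}\widehat F(n)\overline{\widehat G(n)}$ (Maclaurin coefficients). For an analytic self-map $\Phi$ of $\Omega$, $C_{\Phi}f=f\circ\Phi$. A bounded operator $T$ is normal if $TT^*=T^*T$. *)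

theory Defs
  imports "HOL-Complex_Analysis.Complex_Analysis"
begin

text \<open>The inverse of a holomorphic bijection between open sets is automatically holomorphic.\<close>

definition riemann_map :: "(complex \<Rightarrow> complex) \<Rightarrow> complex set \<Rightarrow> bool" where
  "riemann_map \<tau> \<Omega> \<longleftrightarrow> \<tau> holomorphic_on ball 0 1 \<and> bij_betw \<tau> (ball 0 1) \<Omega>"

text \<open>The formula is only required on the disc. Holomorphy of \<open>\<tau>\<close> on the disc, together with
  \<open>a * d - b * c \<noteq> 0\<close>, rules out zeros of \<open>c * z + d\<close> there, so division by zero plays no role.\<close>

definition linear_fractional_riemann_map ::
    "complex \<Rightarrow> complex \<Rightarrow> complex \<Rightarrow> complex \<Rightarrow> (complex \<Rightarrow> complex) \<Rightarrow> complex set \<Rightarrow> bool" where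
  "linear_fractional_riemann_map a b c d \<tau> \<Omega> \<longleftrightarrow>
     riemann_map \<tau> \<Omega> \<and> a * d - b * c \<noteq> 0 \<and>
     (\<forall>z\<in>ball 0 1. \<tau> z = (a * z + b) / (c * z + d))"

definition sqrt_deriv_branch :: "(complex \<Rightarrow> complex) \<Rightarrow> (complex \<Rightarrow> complex) \<Rightarrow> bool" where
  "sqrt_deriv_branch \<tau> \<sigma> \<longleftrightarrow>
     \<sigma> holomorphic_on ball 0 1 \<and> (\<forall>z\<in>ball 0 1. (\<sigma> z)\<^sup>2 = deriv \<tau> z)"

text \<open>The integral of \<open>h\<close> with respect to arc length \<open>|dw|\<close> along the path \<open>\<gamma>\<close>.\<close>

definition arclength_integral :: "(real \<Rightarrow> complex) \<Rightarrow> (complex \<Rightarrow> real) \<Rightarrow> real" where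
  "arclength_integral \<gamma> h =
     integral {0..1} (\<lambda>t. h (\<gamma> t) * norm (vector_derivative \<gamma> (at t within {0..1})))"

definition hs_mean :: "(complex \<Rightarrow> complex) \<Rightarrow> (complex \<Rightarrow> complex) \<Rightarrow> real \<Rightarrow> real" where
  "hs_mean \<tau> f \<rho> =
     1 / (2 * pi) * arclength_integral (\<tau> \<circ> circlepath 0 \<rho>) (\<lambda>w. (norm (f w))\<^sup>2)"

text \<open>Functions \<open>\<Omega> \<rightarrow> \<complex>\<close> are represented by total functions whose values off \<open>\<Omega>\<close> are
  irrelevant: norm and inner product only depend on the values on \<open>\<Omega>\<close>, and equality of elements of
  the space is equality on \<open>\<Omega>\<close>.\<close>

definition hs_space :: "complex set \<Rightarrow> (complex \<Rightarrow> complex) \<Rightarrow> (complex \<Rightarrow> complex) set" where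
  "hs_space \<Omega> \<tau> = {f. f holomorphic_on \<Omega> \<and> bdd_above (hs_mean \<tau> f ` {0<..<1})}"

definition hs_norm :: "(complex \<Rightarrow> complex) \<Rightarrow> (complex \<Rightarrow> complex) \<Rightarrow> real" where
  "hs_norm \<tau> f = sqrt (SUP \<rho>\<in>{0<..<1}. hs_mean \<tau> f \<rho>)"

definition maclaurin_coeff :: "(complex \<Rightarrow> complex) \<Rightarrow> nat \<Rightarrow> complex" where
  "maclaurin_coeff F n = (deriv ^^ n) F 0 / fact n"

definition hardy_inner :: "(complex \<Rightarrow> complex) \<Rightarrow> (complex \<Rightarrow> complex) \<Rightarrow> complex" where
  "hardy_inner F G = (\<Sum>n. maclaurin_coeff F n * cnj (maclaurin_coeff G n))"

definition hs_V ::
    "(complex \<Rightarrow> complex) \<Rightarrow> (complex \<Rightarrow> complex) \<Rightarrow> (complex \<Rightarrow> complex) \<Rightarrow> complex \<Rightarrow> complex" where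
  "hs_V \<tau> \<sigma> f = (\<lambda>z. f (\<tau> z) * \<sigma> z)"

definition hs_inner ::
    "(complex \<Rightarrow> complex) \<Rightarrow> (complex \<Rightarrow> complex) \<Rightarrow> (complex \<Rightarrow> complex) \<Rightarrow> (complex \<Rightarrow> complex) \<Rightarrow> complex" where
  "hs_inner \<tau> \<sigma> f g = hardy_inner (hs_V \<tau> \<sigma> f) (hs_V \<tau> \<sigma> g)"

type_synonym operator = "(complex \<Rightarrow> complex) \<Rightarrow> complex \<Rightarrow> complex"

definition comp_op :: "(complex \<Rightarrow> complex) \<Rightarrow> operator" where
  "comp_op \<Phi> f = f \<circ> \<Phi>"

text \<open>Such an operator respects equality on \<open>\<Omega>\<close>: if \<open>f\<close> and \<open>g\<close> agree on \<open>\<Omega>\<close>, then linearity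
  and the norm bound force \<open>T f\<close> and \<open>T g\<close> to agree on \<open>\<Omega>\<close>.\<close>

definition hs_bounded_op :: "complex set \<Rightarrow> (complex \<Rightarrow> complex) \<Rightarrow> operator \<Rightarrow> bool" where
  "hs_bounded_op \<Omega> \<tau> T \<longleftrightarrow>
     (\<forall>f\<in>hs_space \<Omega> \<tau>. T f \<in> hs_space \<Omega> \<tau>) \<and>
     (\<forall>f\<in>hs_space \<Omega> \<tau>. \<forall>g\<in>hs_space \<Omega> \<tau>. \<forall>\<alpha> \<beta>. \<forall>w\<in>\<Omega>.
        T (\<lambda>u. \<alpha> * f u + \<beta> * g u) w = \<alpha> * T f w + \<beta> * T g w) \<and>
     (\<exists>K. \<forall>f\<in>hs_space \<Omega> \<tau>. hs_norm \<tau> (T f) \<le> K * hs_norm \<tau> f)"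

definition hs_adjoint ::
    "complex set \<Rightarrow> (complex \<Rightarrow> complex) \<Rightarrow> (complex \<Rightarrow> complex) \<Rightarrow> operator \<Rightarrow> operator \<Rightarrow> bool" where
  "hs_adjoint \<Omega> \<tau> \<sigma> T T' \<longleftrightarrow>
     hs_bounded_op \<Omega> \<tau> T' \<and>
     (\<forall>f\<in>hs_space \<Omega> \<tau>. \<forall>g\<in>hs_space \<Omega> \<tau>. hs_inner \<tau> \<sigma> (T f) g = hs_inner \<tau> \<sigma> f (T' g))"

text \<open>The adjoint of a bounded operator exists and is unique up to values off \<open>\<Omega>\<close>, so the
  existential quantifier below amounts to naming it.\<close>

definition hs_normal ::
    "complex set \<Rightarrow> (complex \<Rightarrow> complex) \<Rightarrow> (complex \<Rightarrow> complex) \<Rightarrow> operator \<Rightarrow> bool" where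
  "hs_normal \<Omega> \<tau> \<sigma> T \<longleftrightarrow>
     hs_bounded_op \<Omega> \<tau> T \<and>
     (\<exists>T'. hs_adjoint \<Omega> \<tau> \<sigma> T T' \<and>
           (\<forall>f\<in>hs_space \<Omega> \<tau>. \<forall>w\<in>\<Omega>. T (T' f) w = T' (T f) w))"

end

theory Submission
  imports Defs
begin

text \<open>
  Transporting by \<open>V\<close> and comparing with Maclaurin coefficients (Parseval on circles),
  \<open>H\<^sup>2(\<Omega>)\<close> is an \<open>\<ell>\<^sup>2\<close> space with reproducing kernel
  \<open>K\<^sub>v(w) = 1 / (cnj (\<sigma> p) * \<sigma> q * (1 - cnj p * q))\<close>, where \<open>v = \<tau> p\<close> and \<open>w = \<tau> q\<close>. The adjoint of a
  bounded operator \<open>T\<close> is \<open>T* g (w) = \<langle>g, T K\<^sub>w\<rangle>\<close>. For a linear fractional \<open>\<tau>\<close> the kernel is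
  \<open>\<bar>a d - b c\<bar> / D(w, v)\<close> with
  \<open>D(w, v) = A + B w + cnj B * cnj v + E * w * cnj v\<close>, where \<open>A = \<bar>a\<bar>\<^sup>2 - \<bar>b\<bar>\<^sup>2\<close>,
  \<open>B = cnj b * d - cnj a * c\<close> and \<open>E = \<bar>c\<bar>\<^sup>2 - \<bar>d\<bar>\<^sup>2\<close>. In both cases \<open>\<Phi>\<^sub>s\<close> is the affine map that makes
  \<open>K\<^sub>w (\<Phi> v)\<close> a constant multiple of \<open>K\<close> at \<open>\<Phi>\<^sub>s w\<close>, so that the adjoint of \<open>C\<^sub>\<Phi>\<close> is a multiple of the composition
  operator of \<open>\<Phi>\<^sub>s\<close>. As \<open>H\<^sup>2(\<Omega>)\<close> separates points, normality means that \<open>\<Phi>\<close> and \<open>\<Phi>\<^sub>s\<close> commute. In (1) this is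
  the stated identity; in (2) both maps fix \<open>- cnj B / E\<close> and hence commute.
\<close>

section \<open>Power series on the unit disc and square-summable sequences\<close>

lemma maclaurin_coeff_sums:
  assumes "F holomorphic_on ball 0 1" "norm z < 1"
  shows "(\<lambda>n. maclaurin_coeff F n * z ^ n) sums F z"
  using holomorphic_power_series[OF assms(1), of z] assms(2)
  by (simp add: maclaurin_coeff_def)

lemma maclaurin_coeff_unique:
  assumes "\<And>z. norm z < 1 \<Longrightarrow> (\<lambda>n. x n * z ^ n) sums F z"
  shows "maclaurin_coeff F n = x n"
proof -
  have "eventually (\<lambda>z::complex. z \<in> ball 0 1) (nhds 0)"
    by (rule eventually_nhds_in_open) auto
  then have "F has_fps_expansion Abs_fps x"
    by (intro has_fps_expansionI) (auto elim!: eventually_mono intro: assms)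
  then show ?thesis
    using fps_nth_fps_expansion[of F "Abs_fps x" n] by (simp add: maclaurin_coeff_def)
qed

lemma maclaurin_coeff_cong:
  assumes "\<And>z. norm z < 1 \<Longrightarrow> F z = G z"
  shows "maclaurin_coeff F n = maclaurin_coeff G n"
proof -
  have "eventually (\<lambda>z::complex. z \<in> ball 0 1) (nhds 0)"
    by (rule eventually_nhds_in_open) auto
  then have "eventually (\<lambda>z. F z = G z) (nhds 0)"
    by (auto elim!: eventually_mono intro: assms)
  then show ?thesis
    by (simp add: maclaurin_coeff_def higher_deriv_cong_ev)
qed

lemma power_series_holomorphic_on_unit_disc:
  fixes F :: "complex \<Rightarrow> complex"
  assumes "\<And>z. norm z < 1 \<Longrightarrow> (\<lambda>n. x n * z ^ n) sums F z"
  shows "F holomorphic_on ball 0 1"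
  using power_series_holomorphic[of 0 1 x F] assms by simp

section \<open>Orthogonality of characters and Parseval's identity on circles\<close>

text \<open>For \<open>k \<noteq> 0\<close> the antiderivative \<open>exp (c * t) / c\<close> takes
  equal values at 0 and 1, because \<open>exp c = 1\<close>.\<close>

lemma integral_exp_int:
  fixes k :: int
  shows "((\<lambda>t. exp (2 * of_real pi * \<i> * of_int k * of_real t)) has_integral (if k = 0 then 1 else 0))
           {0..1::real}"
proof (cases "k = 0")
  case True
  then show ?thesis
    using has_integral_const_real[of "1::complex" 0 1] by simp
next
  case False
  define c where "c = 2 * of_real pi * \<i> * of_int k"
  have c: "c \<noteq> 0"
    using False by (simp add: c_def)
  have "exp c = 1"
    unfolding c_def exp_eq_1 by (auto intro!: exI[of _ k])
  moreover have "((\<lambda>t. exp (c * of_real t)) has_integral (exp (c * of_real 1) / c - exp (c * of_real 0) / c)) {0..1::real}"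
    by (rule fundamental_theorem_of_calculus)
      (auto intro!: derivative_eq_intros has_vector_derivative_real_field simp: c)
  ultimately show ?thesis
    using False by (simp add: c_def)
qed

text \<open>The squared modulus is a double sum of characters with frequencies \<open>n - m\<close>,
  and only the diagonal survives integration. The parameter interval has length 1, so no factor 2 pi
  appears.\<close>

lemma integral_norm_square_polynomial_circlepath:
  fixes a :: "nat \<Rightarrow> complex"
  shows "((\<lambda>t. (norm (\<Sum>n<N. a n * circlepath 0 \<rho> t ^ n))\<^sup>2) has_integral
           (\<Sum>n<N. (norm (a n))\<^sup>2 * \<rho> ^ (2 * n))) {0..1}"
proof -
  let ?e = "\<lambda>k t. exp (2 * of_real pi * \<i> * of_int k * of_real t) :: complex"
  have term_eq: "a n * circlepath 0 \<rho> t ^ n * cnj (a m * circlepath 0 \<rho> t ^ m)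
      = a n * cnj (a m) * of_real \<rho> ^ (n + m) * ?e (int n - int m) t" for n m t
  proof -
    have "exp (2 * of_real pi * \<i> * of_real t) ^ n * cnj (exp (2 * of_real pi * \<i> * of_real t) ^ m)
        = ?e (int n - int m) t"
      by (simp add: exp_of_nat_mult[symmetric] exp_cnj exp_add[symmetric] algebra_simps)
    then show ?thesis
      by (simp add: circlepath power_mult_distrib power_add mult_ac)
  qed
  have square_eq: "of_real ((norm (\<Sum>n<N. a n * circlepath 0 \<rho> t ^ n))\<^sup>2)
      = (\<Sum>n<N. \<Sum>m<N. a n * cnj (a m) * of_real \<rho> ^ (n + m) * ?e (int n - int m) t)" for t
    unfolding complex_norm_square cnj_sum sum_product term_eq ..
  have "((\<lambda>t. of_real ((norm (\<Sum>n<N. a n * circlepath 0 \<rho> t ^ n))\<^sup>2)) has_integral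
         (\<Sum>n<N. \<Sum>m<N. a n * cnj (a m) * of_real \<rho> ^ (n + m) * (if int n - int m = 0 then 1 else 0))) {0..1}"
    unfolding square_eq by (intro has_integral_sum has_integral_mult_right integral_exp_int) auto
  also have "(\<Sum>n<N. \<Sum>m<N. a n * cnj (a m) * of_real \<rho> ^ (n + m) * (if int n - int m = 0 then 1 else 0))
      = (\<Sum>n<N. a n * cnj (a n) * of_real \<rho> ^ (n + n))"
    by (intro sum.cong refl) (simp add: if_distrib sum.delta cong: if_cong)
  also have "\<dots> = of_real (\<Sum>n<N. (norm (a n))\<^sup>2 * \<rho> ^ (2 * n))"
    by (simp add: complex_norm_square[symmetric] mult_2 flip: of_real_power of_real_mult)
  finally have "((\<lambda>t. complex_of_real ((norm (\<Sum>n<N. a n * circlepath 0 \<rho> t ^ n))\<^sup>2)) has_integral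
      complex_of_real (\<Sum>n<N. (norm (a n))\<^sup>2 * \<rho> ^ (2 * n))) {0..1}" .
  from has_integral_Re[OF this] show ?thesis
    by simp
qed

text \<open>Dominated convergence carries the polynomial identity over to \<open>F\<close>. On a
  circle of radius below 1 all partial sums are bounded by the sum \<open>M\<close> of the absolute
  values.\<close>

lemma parseval_circlepath:
  assumes F: "F holomorphic_on ball 0 1" and \<rho>: "0 < \<rho>" "\<rho> < 1"
  shows "(\<lambda>n. (norm (maclaurin_coeff F n))\<^sup>2 * \<rho> ^ (2 * n)) sums
           integral {0..1} (\<lambda>t. (norm (F (circlepath 0 \<rho> t)))\<^sup>2)"
proof -
  define a where "a = maclaurin_coeff F"
  define S where "S N t = (norm (\<Sum>n<N. a n * circlepath 0 \<rho> t ^ n))\<^sup>2" for N t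
  define M where "M = (\<Sum>n. norm (a n) * \<rho> ^ n)"
  have norm_circ: "norm (circlepath 0 \<rho> t) = \<rho>" for t
    using \<rho> by (simp add: circlepath norm_mult)
  \<comment> \<open>Convergence at a radius strictly between \<open>\<rho>\<close> and 1 gives
    absolute convergence at \<open>\<rho>\<close>.\<close>
  define q where "q = (1 + \<rho>) / 2"
  have q: "0 < q" "q < 1" "\<rho> < q"
    using \<rho> by (auto simp: q_def)
  have "summable (\<lambda>n. a n * of_real q ^ n)"
    using maclaurin_coeff_sums[OF F, of "of_real q"] q by (auto simp: a_def sums_iff)
  then have "summable (\<lambda>n. norm (a n * of_real \<rho> ^ n))"
    by (rule powser_insidea) (use q \<rho> in auto)
  then have summable: "summable (\<lambda>n. norm (a n) * \<rho> ^ n)"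
    using \<rho> by (simp add: norm_mult norm_power)
  have "(\<lambda>N. integral {0..1} (S N)) \<longlonglongrightarrow> integral {0..1} (\<lambda>t. (norm (F (circlepath 0 \<rho> t)))\<^sup>2)"
  proof (rule dominated_convergence(2))
    show "S N integrable_on {0..1}" for N
      unfolding S_def using integral_norm_square_polynomial_circlepath by blast
    show "(\<lambda>_. M\<^sup>2) integrable_on {0..1::real}"
      by (rule integrable_const_ivl)
    show "norm (S N t) \<le> M\<^sup>2" for N t
    proof -
      have "norm (\<Sum>n<N. a n * circlepath 0 \<rho> t ^ n) \<le> (\<Sum>n<N. norm (a n) * \<rho> ^ n)"
        by (rule order_trans[OF norm_sum]) (simp add: norm_mult norm_power norm_circ)
      also have "\<dots> \<le> M"
        unfolding M_def by (rule sum_le_suminf[OF summable]) (use \<rho> in auto)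
      finally show ?thesis
        by (simp add: S_def power_mono)
    qed
    show "(\<lambda>N. S N t) \<longlonglongrightarrow> (norm (F (circlepath 0 \<rho> t)))\<^sup>2" for t
      using maclaurin_coeff_sums[OF F, of "circlepath 0 \<rho> t"] \<rho> norm_circ[of t]
      unfolding S_def a_def sums_def by (intro tendsto_intros) auto
  qed
  moreover have "integral {0..1} (S N) = (\<Sum>n<N. (norm (a n))\<^sup>2 * \<rho> ^ (2 * n))" for N
    unfolding S_def by (rule integral_unique[OF integral_norm_square_polynomial_circlepath])
  ultimately show ?thesis
    by (simp add: sums_def a_def)
qed

section \<open>Radial suprema of power series with nonnegative coefficients\<close>

text \<open>Each \<open>m \<rho>\<close> is at most the full sum since \<open>\<rho> < 1\<close>.
  Conversely, a bound on all \<open>m \<rho>\<close> bounds every finite partial sum, in which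
  \<open>\<rho>\<close> may tend to 1. The exponent is odd because the arc length element
  contributes one more factor \<open>\<rho>\<close>.\<close>

lemma abel_limit_nonneg:
  fixes x :: "nat \<Rightarrow> real" and m :: "real \<Rightarrow> real"
  assumes nonneg: "\<And>n. x n \<ge> 0"
    and m: "\<And>\<rho>. 0 < \<rho> \<Longrightarrow> \<rho> < 1 \<Longrightarrow> (\<lambda>n. x n * \<rho> ^ (2 * n + 1)) sums m \<rho>"
  shows "bdd_above (m ` {0<..<1}) \<longleftrightarrow> summable x"
    and "summable x \<Longrightarrow> (SUP \<rho>\<in>{0<..<1}. m \<rho>) = suminf x"
proof -
  have upper: "m \<rho> \<le> suminf x" if "summable x" "\<rho> \<in> {0<..<1}" for \<rho>
  proof -
    have le: "x n * \<rho> ^ (2 * n + 1) \<le> x n" for n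
      using that nonneg[of n] by (intro mult_left_le power_le_one) auto
    have "m \<rho> = (\<Sum>n. x n * \<rho> ^ (2 * n + 1))" "summable (\<lambda>n. x n * \<rho> ^ (2 * n + 1))"
      using m[of \<rho>] that by (auto simp: sums_iff)
    then show ?thesis
      using suminf_le[OF le] that by simp
  qed
  have lower: "(\<Sum>n<N. x n) \<le> B" if B: "\<And>\<rho>. \<rho> \<in> {0<..<1} \<Longrightarrow> m \<rho> \<le> B" for B N
  proof (rule tendsto_le)
    show "((\<lambda>\<rho>. \<Sum>n<N. x n * \<rho> ^ (2 * n + 1)) \<longlongrightarrow> (\<Sum>n<N. x n)) (at_left 1)"
      by (auto intro!: tendsto_eq_intros)
    have "(\<Sum>n<N. x n * \<rho> ^ (2 * n + 1)) \<le> B" if "\<rho> \<in> {0<..<1}" for \<rho>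
    proof -
      have "(\<Sum>n<N. x n * \<rho> ^ (2 * n + 1)) \<le> (\<Sum>n. x n * \<rho> ^ (2 * n + 1))"
        using m[of \<rho>] that nonneg by (intro sum_le_suminf) (auto simp: sums_iff)
      also have "\<dots> = m \<rho>"
        using m[of \<rho>] that by (simp add: sums_iff)
      finally show ?thesis
        using B[OF that] by simp
    qed
    then show "eventually (\<lambda>\<rho>. (\<Sum>n<N. x n * \<rho> ^ (2 * n + 1)) \<le> B) (at_left 1)"
      using eventually_at_left_real[of 0 1] by (auto elim!: eventually_mono)
  qed (auto simp: trivial_limit_at_left_real)
  show "bdd_above (m ` {0<..<1}) \<longleftrightarrow> summable x"
  proof
    assume "bdd_above (m ` {0<..<1})"
    then obtain B where "\<And>\<rho>. \<rho> \<in> {0<..<1} \<Longrightarrow> m \<rho> \<le> B"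
      unfolding bdd_above_def by blast
    then show "summable x"
      using nonneg lower[of B] by (intro summableI_nonneg_bounded[of _ B]) auto
  qed (auto intro!: bdd_aboveI upper)
  show "(SUP \<rho>\<in>{0<..<1}. m \<rho>) = suminf x" if sx: "summable x"
  proof (rule antisym)
    show "(SUP \<rho>\<in>{0<..<1}. m \<rho>) \<le> suminf x"
      by (rule cSUP_least) (use upper sx in auto)
    have "m \<rho> \<le> (SUP \<rho>\<in>{0<..<1}. m \<rho>)" if "\<rho> \<in> {0<..<1}" for \<rho>
      using that sx upper by (intro cSUP_upper bdd_aboveI[of _ "suminf x"]) auto
    then show "suminf x \<le> (SUP \<rho>\<in>{0<..<1}. m \<rho>)"
      using lower sx by (intro suminf_le_const) auto
  qed
qed

section \<open>Square-summable sequences\<close>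

definition l2_norm :: "(nat \<Rightarrow> complex) \<Rightarrow> real" where
  "l2_norm x = sqrt (\<Sum>n. (norm (x n))\<^sup>2)"

definition square_summable :: "(nat \<Rightarrow> complex) \<Rightarrow> bool" where
  "square_summable x \<longleftrightarrow> summable (\<lambda>n. (norm (x n))\<^sup>2)"

lemma l2_norm_nonneg: "l2_norm x \<ge> 0" if "square_summable x"
  using that by (auto simp: l2_norm_def square_summable_def intro!: suminf_nonneg)

lemma L2_set_le_l2_norm:
  assumes "square_summable x"
  shows "L2_set (\<lambda>n. norm (x n)) {..<N} \<le> l2_norm x"
  using assms unfolding L2_set_def l2_norm_def square_summable_def
  by (intro real_sqrt_le_mono sum_le_suminf) auto

text \<open>Transfers inequalities for the finite \<open>L2_set\<close> to infinite sequences,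
  giving membership and the norm bound at once.\<close>

lemma square_summableI_bounded:
  assumes "\<And>N. L2_set (\<lambda>n. norm (x n)) {..<N} \<le> B"
  shows "square_summable x" "l2_norm x \<le> B"
proof -
  \<comment> \<open>At \<open>N = 0\<close> the hypothesis reads \<open>0 \<le> B\<close>, which is
    needed for squaring the bound.\<close>
  have B: "B \<ge> 0"
    using assms[of 0] by simp
  have bound: "(\<Sum>n<N. (norm (x n))\<^sup>2) \<le> B\<^sup>2" for N
    using assms[of N] B by (simp add: L2_set_def sqrt_le_D)
  then show sq: "square_summable x"
    unfolding square_summable_def
    by (intro summableI_nonneg_bounded[of _ "B\<^sup>2"]) auto
  then have "(\<Sum>n. (norm (x n))\<^sup>2) \<le> B\<^sup>2"
    unfolding square_summable_def by (rule suminf_le_const[OF _ bound])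
  then show "l2_norm x \<le> B"
    unfolding l2_norm_def by (rule real_le_lsqrt[OF B])
qed

text \<open>The finite Cauchy-Schwarz inequality bounds all partial sums by the same
  constant.\<close>

lemma square_summable_inner:
  assumes x: "square_summable x" and y: "square_summable y"
  shows "summable (\<lambda>n. norm (x n * cnj (y n)))"
    and "norm (\<Sum>n. x n * cnj (y n)) \<le> l2_norm x * l2_norm y"
proof -
  have bound: "(\<Sum>n<N. norm (x n * cnj (y n))) \<le> l2_norm x * l2_norm y" for N
  proof -
    have "(\<Sum>n<N. norm (x n * cnj (y n)))
        \<le> L2_set (\<lambda>n. norm (x n)) {..<N} * L2_set (\<lambda>n. norm (y n)) {..<N}"
      using L2_set_mult_ineq[of "\<lambda>n. norm (x n)" "\<lambda>n. norm (y n)" "{..<N}"] by (simp add: norm_mult)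
    also have "\<dots> \<le> l2_norm x * l2_norm y"
      by (intro mult_mono L2_set_le_l2_norm x y l2_norm_nonneg L2_set_nonneg)
    finally show ?thesis .
  qed
  then show summable: "summable (\<lambda>n. norm (x n * cnj (y n)))"
    by (intro summableI_nonneg_bounded[of _ "l2_norm x * l2_norm y"]) auto
  show "norm (\<Sum>n. x n * cnj (y n)) \<le> l2_norm x * l2_norm y"
    by (rule order_trans[OF summable_norm[OF summable] suminf_le_const[OF summable bound]])
qed

lemma square_summable_add:
  assumes x: "square_summable x" and y: "square_summable y"
  shows "square_summable (\<lambda>n. \<alpha> * x n + \<beta> * y n)"
proof (rule square_summableI_bounded(1))
  fix N
  have "L2_set (\<lambda>n. norm (\<alpha> * x n + \<beta> * y n)) {..<N}
      \<le> L2_set (\<lambda>n. norm \<alpha> * norm (x n) + norm \<beta> * norm (y n)) {..<N}"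
    by (intro L2_set_mono) (auto intro: order_trans[OF norm_triangle_ineq] simp: norm_mult)
  also have "\<dots> \<le> L2_set (\<lambda>n. norm \<alpha> * norm (x n)) {..<N} + L2_set (\<lambda>n. norm \<beta> * norm (y n)) {..<N}"
    by (rule L2_set_triangle_ineq)
  also have "\<dots> = norm \<alpha> * L2_set (\<lambda>n. norm (x n)) {..<N} + norm \<beta> * L2_set (\<lambda>n. norm (y n)) {..<N}"
    by (simp add: L2_set_right_distrib)
  also have "\<dots> \<le> norm \<alpha> * l2_norm x + norm \<beta> * l2_norm y"
    by (intro add_mono mult_left_mono L2_set_le_l2_norm x y) auto
  finally show "L2_set (\<lambda>n. norm (\<alpha> * x n + \<beta> * y n)) {..<N} \<le> norm \<alpha> * l2_norm x + norm \<beta> * l2_norm y" .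
qed

lemma square_summable_finite_support:
  assumes "\<And>n. n \<ge> N \<Longrightarrow> x n = 0"
  shows "square_summable x" "l2_norm x = L2_set (\<lambda>n. norm (x n)) {..<N}"
proof -
  have "(\<lambda>n. (norm (x n))\<^sup>2) sums (\<Sum>n<N. (norm (x n))\<^sup>2)"
    by (rule sums_finite) (use assms in auto)
  then show "square_summable x" "l2_norm x = L2_set (\<lambda>n. norm (x n)) {..<N}"
    by (auto simp: square_summable_def l2_norm_def L2_set_def sums_iff)
qed

text \<open>The squared norm of a tail is the total sum minus a partial sum. This makes truncations
  converge in norm, which continuity of bounded operators exploits.\<close>

lemma l2_norm_tail:
  assumes "square_summable x"
  shows "(\<lambda>N. l2_norm (\<lambda>n. if n < N then 0 else x n)) \<longlonglongrightarrow> 0"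
proof -
  let ?y = "\<lambda>n. (norm (x n))\<^sup>2"
  have y: "summable ?y"
    using assms by (simp add: square_summable_def)
  have "l2_norm (\<lambda>n. if n < N then 0 else x n) = sqrt (suminf ?y - (\<Sum>n<N. ?y n))" for N
  proof -
    have "(\<lambda>n. ?y n - (if n < N then ?y n else 0)) sums (suminf ?y - (\<Sum>n<N. ?y n))"
      using sums_If_finite_set[of "{..<N}" ?y] y by (intro sums_diff) auto
    then show ?thesis
      unfolding l2_norm_def by (subst sums_unique, assumption) (auto intro!: suminf_cong)
  qed
  moreover have "(\<lambda>N. sqrt (suminf ?y - (\<Sum>n<N. ?y n))) \<longlonglongrightarrow> sqrt (suminf ?y - suminf ?y)"
    using summable_LIMSEQ[OF y] by (intro tendsto_intros)
  ultimately show ?thesis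
    by simp
qed

section \<open>The Hardy-Smirnov space of a Riemann map\<close>

locale hardy_smirnov =
  fixes \<Omega> :: "complex set" and \<tau> \<sigma> :: "complex \<Rightarrow> complex"
  assumes open_domain: "open \<Omega>"
    and riemann_map: "riemann_map \<tau> \<Omega>"
    and sqrt_deriv_branch: "sqrt_deriv_branch \<tau> \<sigma>"
begin

text \<open>The inverse Riemann map; only its values on \<open>\<Omega>\<close> are
  meaningful.\<close>

definition \<psi> :: "complex \<Rightarrow> complex" where
  "\<psi> = inv_into (ball 0 1) \<tau>"

definition hs_coeff :: "(complex \<Rightarrow> complex) \<Rightarrow> nat \<Rightarrow> complex" where
  "hs_coeff f = maclaurin_coeff (hs_V \<tau> \<sigma> f)"

text \<open>The preimage of the monomial \<open>z ^ n\<close> under \<open>V\<close>; these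
  functions form the orthonormal basis.\<close>

definition basis_fun :: "nat \<Rightarrow> complex \<Rightarrow> complex" where
  "basis_fun n w = \<psi> w ^ n / \<sigma> (\<psi> w)"

text \<open>The Szego kernel of the disc, transported by \<open>V\<close>.\<close>

definition kernel :: "complex \<Rightarrow> complex \<Rightarrow> complex" where
  "kernel v w = 1 / (cnj (\<sigma> (\<psi> v)) * \<sigma> (\<psi> w) * (1 - cnj (\<psi> v) * \<psi> w))"

section \<open>The Riemann map, its inverse and the square root of its derivative\<close>

lemma \<tau>_holomorphic: "\<tau> holomorphic_on ball 0 1"
  and inj_\<tau>: "inj_on \<tau> (ball 0 1)"
  and \<tau>_image: "\<tau> ` ball 0 1 = \<Omega>"
  using riemann_map by (simp_all add: riemann_map_def bij_betw_def)

lemma \<tau>_in: "norm z < 1 \<Longrightarrow> \<tau> z \<in> \<Omega>"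
  using imageI[of z "ball 0 1" \<tau>] \<tau>_image by simp

lemma \<psi>_\<tau> [simp]: "norm z < 1 \<Longrightarrow> \<psi> (\<tau> z) = z"
  using inj_\<tau> by (simp add: \<psi>_def)

lemma \<tau>_\<psi> [simp]: "w \<in> \<Omega> \<Longrightarrow> \<tau> (\<psi> w) = w"
  unfolding \<psi>_def using f_inv_into_f[of w \<tau> "ball 0 1"] \<tau>_image by simp

lemma norm_\<psi>: "w \<in> \<Omega> \<Longrightarrow> norm (\<psi> w) < 1"
  unfolding \<psi>_def using \<tau>_image inv_into_into[of w \<tau> "ball 0 1"] by simp

lemma \<psi>_holomorphic: "\<psi> holomorphic_on \<Omega>"
proof (rule holomorphic_has_inverse[OF \<tau>_holomorphic open_ball inj_\<tau>])
  fix g assume g: "g holomorphic_on \<tau> ` ball 0 1" "\<And>z. z \<in> ball 0 1 \<Longrightarrow> g (\<tau> z) = z"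
  show ?thesis
  proof (rule holomorphic_transform)
    show "g holomorphic_on \<Omega>"
      using g(1) by (simp only: \<tau>_image)
    show "g w = \<psi> w" if "w \<in> \<Omega>" for w
      using g(2)[of "\<psi> w"] norm_\<psi>[OF that] that by simp
  qed
qed

lemma \<sigma>_holomorphic: "\<sigma> holomorphic_on ball 0 1"
  and \<sigma>_square: "norm z < 1 \<Longrightarrow> (\<sigma> z)\<^sup>2 = deriv \<tau> z"
  using sqrt_deriv_branch by (simp_all add: sqrt_deriv_branch_def)

text \<open>An injective holomorphic map has no critical points, and \<open>\<sigma>\<close> squares
  to the derivative of \<open>\<tau>\<close>. Hence \<open>V\<close> can be inverted by
  division.\<close>

lemma \<sigma>_nonzero: "norm z < 1 \<Longrightarrow> \<sigma> z \<noteq> 0"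
  using holomorphic_injective_imp_regular[OF \<tau>_holomorphic open_ball inj_\<tau>, of z] \<sigma>_square[of z]
  by (metis mem_ball_0 zero_power2)

lemma \<sigma>_\<psi>_nonzero: "w \<in> \<Omega> \<Longrightarrow> \<sigma> (\<psi> w) \<noteq> 0"
  by (simp add: \<sigma>_nonzero norm_\<psi>)

lemma \<sigma>_\<psi>_holomorphic: "(\<lambda>w. \<sigma> (\<psi> w)) holomorphic_on \<Omega>"
proof -
  have "(\<sigma> \<circ> \<psi>) holomorphic_on \<Omega>"
    by (rule holomorphic_on_compose_gen[OF \<psi>_holomorphic \<sigma>_holomorphic])
      (simp add: image_subset_iff norm_\<psi>)
  then show ?thesis
    by (simp add: o_def)
qed

section \<open>Expansion of elements in powers of the inverse Riemann map\<close>

lemma hs_V_holomorphic: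
  assumes "f holomorphic_on \<Omega>"
  shows "hs_V \<tau> \<sigma> f holomorphic_on ball 0 1"
proof -
  have "(f \<circ> \<tau>) holomorphic_on ball 0 1"
    by (rule holomorphic_on_compose_gen[OF \<tau>_holomorphic assms]) (simp add: \<tau>_image)
  from holomorphic_on_mult[OF this \<sigma>_holomorphic] show ?thesis
    by (simp add: hs_V_def o_def)
qed

lemma hs_coeff_sums:
  assumes "f holomorphic_on \<Omega>" "w \<in> \<Omega>"
  shows "(\<lambda>n. hs_coeff f n * \<psi> w ^ n) sums (f w * \<sigma> (\<psi> w))"
  using maclaurin_coeff_sums[OF hs_V_holomorphic[OF assms(1)] norm_\<psi>[OF assms(2)]] assms(2)
  by (simp add: hs_coeff_def hs_V_def)

lemma hs_coeff_unique:
  assumes "\<And>w. w \<in> \<Omega> \<Longrightarrow> (\<lambda>n. x n * \<psi> w ^ n) sums (f w * \<sigma> (\<psi> w))"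
  shows "hs_coeff f n = x n"
  unfolding hs_coeff_def
proof (rule maclaurin_coeff_unique)
  show "(\<lambda>n. x n * z ^ n) sums hs_V \<tau> \<sigma> f z" if "norm z < 1" for z
    using assms[OF \<tau>_in[OF that]] that by (simp add: hs_V_def)
qed

text \<open>The power series makes \<open>V f\<close> holomorphic on the disc; composing with
  \<open>\<psi>\<close> and dividing by \<open>\<sigma>\<close> recovers \<open>f\<close> on
  \<open>\<Omega>\<close>.\<close>

lemma holomorphic_if_hs_coeff_sums:
  assumes "\<And>w. w \<in> \<Omega> \<Longrightarrow> (\<lambda>n. x n * \<psi> w ^ n) sums (f w * \<sigma> (\<psi> w))"
  shows "f holomorphic_on \<Omega>"
proof -
  have "hs_V \<tau> \<sigma> f holomorphic_on ball 0 1"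
  proof (rule power_series_holomorphic_on_unit_disc)
    show "(\<lambda>n. x n * z ^ n) sums hs_V \<tau> \<sigma> f z" if "norm z < 1" for z
      using assms[OF \<tau>_in[OF that]] that by (simp add: hs_V_def)
  qed
  then have "(hs_V \<tau> \<sigma> f \<circ> \<psi>) holomorphic_on \<Omega>"
    by (rule holomorphic_on_compose_gen[OF \<psi>_holomorphic]) (simp add: image_subset_iff norm_\<psi>)
  then have "(\<lambda>w. hs_V \<tau> \<sigma> f (\<psi> w) / \<sigma> (\<psi> w)) holomorphic_on \<Omega>"
    unfolding o_def by (rule holomorphic_on_divide[OF _ \<sigma>_\<psi>_holomorphic \<sigma>_\<psi>_nonzero])
  then show ?thesis
    by (rule holomorphic_transform) (simp add: hs_V_def \<sigma>_\<psi>_nonzero)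
qed

lemma hs_coeff_cong: "(\<And>w. w \<in> \<Omega> \<Longrightarrow> f w = g w) \<Longrightarrow> hs_coeff f = hs_coeff g"
  unfolding hs_coeff_def by (rule ext, rule maclaurin_coeff_cong) (simp add: hs_V_def \<tau>_in)

section \<open>Norm and inner product through coefficients\<close>

text \<open>Change of variables turns \<open>|dw|\<close> into \<open>|\<tau>'| |dz|\<close>, and
  \<open>|\<tau>'| = |\<sigma>|^2\<close> is absorbed into \<open>V f\<close>. Parseval then
  applies. The speed \<open>2 * pi * \<rho>\<close> of the circle cancels the normalisation up to
  one factor \<open>\<rho>\<close>.\<close>

lemma hs_mean_sums:
  assumes f: "f holomorphic_on \<Omega>" and \<rho>: "0 < \<rho>" "\<rho> < 1"
  shows "(\<lambda>n. (norm (hs_coeff f n))\<^sup>2 * \<rho> ^ (2 * n + 1)) sums hs_mean \<tau> f \<rho>"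
proof -
  let ?F = "hs_V \<tau> \<sigma> f" and ?\<gamma> = "circlepath 0 \<rho>"
  have "(norm (f (\<tau> (?\<gamma> t))))\<^sup>2 * norm (vector_derivative (\<tau> \<circ> ?\<gamma>) (at t within {0..1}))
      = 2 * pi * \<rho> * (norm (?F (?\<gamma> t)))\<^sup>2" if "t \<in> {0..1}" for t
  proof -
    have norm_\<gamma>: "norm (?\<gamma> t) < 1"
      using \<rho> by (simp add: circlepath norm_mult)
    have "(?\<gamma> has_vector_derivative vector_derivative ?\<gamma> (at t)) (at t within {0..1})"
      unfolding vector_derivative_circlepath by (rule has_vector_derivative_circlepath)
    moreover have "(\<tau> has_field_derivative deriv \<tau> (?\<gamma> t)) (at (?\<gamma> t))"
      using \<tau>_holomorphic norm_\<gamma> by (intro holomorphic_derivI[of _ "ball 0 1"]) auto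
    ultimately have "((\<tau> \<circ> ?\<gamma>) has_vector_derivative vector_derivative ?\<gamma> (at t) * deriv \<tau> (?\<gamma> t))
        (at t within {0..1})"
      by (rule field_vector_diff_chain_within[OF _ has_field_derivative_at_within])
    then have "vector_derivative (\<tau> \<circ> ?\<gamma>) (at t within {0..1}) = vector_derivative ?\<gamma> (at t) * deriv \<tau> (?\<gamma> t)"
      by (rule vector_derivative_within_closed_interval[OF zero_less_one that])
    moreover have "norm (vector_derivative ?\<gamma> (at t)) = 2 * pi * \<rho>"
      using \<rho> by (simp add: vector_derivative_circlepath norm_mult)
    ultimately show ?thesis
      by (simp add: norm_mult hs_V_def power_mult_distrib \<sigma>_square[OF norm_\<gamma>, symmetric] norm_power)
  qed
  then have "arclength_integral (\<tau> \<circ> ?\<gamma>) (\<lambda>w. (norm (f w))\<^sup>2)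
      = integral {0..1} (\<lambda>t. 2 * pi * \<rho> * (norm (?F (?\<gamma> t)))\<^sup>2)"
    unfolding arclength_integral_def by (intro integral_cong) simp
  then have "hs_mean \<tau> f \<rho> = \<rho> * integral {0..1} (\<lambda>t. (norm (?F (?\<gamma> t)))\<^sup>2)"
    by (simp add: hs_mean_def)
  then show ?thesis
    using sums_mult[OF parseval_circlepath[OF hs_V_holomorphic[OF f] \<rho>], of \<rho>]
    by (simp add: hs_coeff_def mult_ac)
qed

lemma hs_space_iff: "f \<in> hs_space \<Omega> \<tau> \<longleftrightarrow> f holomorphic_on \<Omega> \<and> square_summable (hs_coeff f)"
  using abel_limit_nonneg(1)[of "\<lambda>n. (norm (hs_coeff f n))\<^sup>2" "hs_mean \<tau> f"] hs_mean_sums[of f]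
  by (auto simp: hs_space_def square_summable_def)

lemma hs_space_holomorphic: "f \<in> hs_space \<Omega> \<tau> \<Longrightarrow> f holomorphic_on \<Omega>"
  and hs_space_square_summable: "f \<in> hs_space \<Omega> \<tau> \<Longrightarrow> square_summable (hs_coeff f)"
  by (simp_all add: hs_space_iff)

lemma hs_norm_eq:
  assumes "f \<in> hs_space \<Omega> \<tau>"
  shows "hs_norm \<tau> f = l2_norm (hs_coeff f)"
  using abel_limit_nonneg(2)[of "\<lambda>n. (norm (hs_coeff f n))\<^sup>2" "hs_mean \<tau> f"] hs_mean_sums[of f] assms
  by (simp add: hs_space_iff square_summable_def hs_norm_def l2_norm_def)

lemma hs_norm_nonneg: "f \<in> hs_space \<Omega> \<tau> \<Longrightarrow> hs_norm \<tau> f \<ge> 0"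
  by (simp add: hs_norm_eq l2_norm_nonneg hs_space_square_summable)

lemma hs_coeff_linear:
  assumes "f holomorphic_on \<Omega>" "g holomorphic_on \<Omega>"
  shows "hs_coeff (\<lambda>u. \<alpha> * f u + \<beta> * g u) = (\<lambda>n. \<alpha> * hs_coeff f n + \<beta> * hs_coeff g n)"
proof (rule ext, rule hs_coeff_unique)
  fix w assume w: "w \<in> \<Omega>"
  show "(\<lambda>n. (\<alpha> * hs_coeff f n + \<beta> * hs_coeff g n) * \<psi> w ^ n) sums ((\<alpha> * f w + \<beta> * g w) * \<sigma> (\<psi> w))"
    using sums_add[OF sums_mult[OF hs_coeff_sums[OF assms(1) w], of \<alpha>]
        sums_mult[OF hs_coeff_sums[OF assms(2) w], of \<beta>]]
    by (simp add: algebra_simps)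
qed

lemma hs_space_linear:
  assumes "f \<in> hs_space \<Omega> \<tau>" "g \<in> hs_space \<Omega> \<tau>"
  shows "(\<lambda>u. \<alpha> * f u + \<beta> * g u) \<in> hs_space \<Omega> \<tau>"
  using assms unfolding hs_space_iff
  by (simp add: hs_coeff_linear square_summable_add holomorphic_on_add holomorphic_on_mult)

lemma hs_inner_eq_suminf: "hs_inner \<tau> \<sigma> f g = (\<Sum>n. hs_coeff f n * cnj (hs_coeff g n))"
  by (simp add: hs_inner_def hardy_inner_def hs_coeff_def)

lemma hs_inner_sums:
  assumes "f \<in> hs_space \<Omega> \<tau>" "g \<in> hs_space \<Omega> \<tau>"
  shows "(\<lambda>n. hs_coeff f n * cnj (hs_coeff g n)) sums hs_inner \<tau> \<sigma> f g"
  unfolding hs_inner_eq_suminf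
  by (rule summable_sums[OF summable_norm_cancel[OF
      square_summable_inner(1)[OF assms[THEN hs_space_square_summable]]]])

lemma hs_inner_cong:
  assumes "\<And>w. w \<in> \<Omega> \<Longrightarrow> f w = f' w" "\<And>w. w \<in> \<Omega> \<Longrightarrow> g w = g' w"
  shows "hs_inner \<tau> \<sigma> f g = hs_inner \<tau> \<sigma> f' g'"
proof -
  have "hs_coeff f = hs_coeff f'" "hs_coeff g = hs_coeff g'"
    by (auto intro!: hs_coeff_cong assms)
  then show ?thesis
    by (simp add: hs_inner_eq_suminf)
qed

lemma hs_inner_cnj:
  assumes "f \<in> hs_space \<Omega> \<tau>" "g \<in> hs_space \<Omega> \<tau>"
  shows "cnj (hs_inner \<tau> \<sigma> f g) = hs_inner \<tau> \<sigma> g f"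
proof (rule sums_unique2)
  show "(\<lambda>n. hs_coeff g n * cnj (hs_coeff f n)) sums cnj (hs_inner \<tau> \<sigma> f g)"
    using iffD2[OF sums_cnj hs_inner_sums[OF assms]] by (simp add: mult.commute)
qed (rule hs_inner_sums[OF assms(2,1)])

lemma hs_inner_linear_left:
  assumes "f \<in> hs_space \<Omega> \<tau>" "g \<in> hs_space \<Omega> \<tau>" "h \<in> hs_space \<Omega> \<tau>"
  shows "hs_inner \<tau> \<sigma> (\<lambda>u. \<alpha> * f u + \<beta> * g u) h = \<alpha> * hs_inner \<tau> \<sigma> f h + \<beta> * hs_inner \<tau> \<sigma> g h"
proof (rule sums_unique2)
  show "(\<lambda>n. hs_coeff (\<lambda>u. \<alpha> * f u + \<beta> * g u) n * cnj (hs_coeff h n)) sums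
      hs_inner \<tau> \<sigma> (\<lambda>u. \<alpha> * f u + \<beta> * g u) h"
    by (intro hs_inner_sums hs_space_linear assms)
  show "(\<lambda>n. hs_coeff (\<lambda>u. \<alpha> * f u + \<beta> * g u) n * cnj (hs_coeff h n)) sums
      (\<alpha> * hs_inner \<tau> \<sigma> f h + \<beta> * hs_inner \<tau> \<sigma> g h)"
    using sums_add[OF sums_mult[OF hs_inner_sums[OF assms(1,3)], of \<alpha>]
        sums_mult[OF hs_inner_sums[OF assms(2,3)], of \<beta>]]
    by (simp add: hs_coeff_linear assms hs_space_holomorphic algebra_simps)
qed

lemma hs_cauchy_schwarz:
  assumes "f \<in> hs_space \<Omega> \<tau>" "g \<in> hs_space \<Omega> \<tau>"
  shows "norm (hs_inner \<tau> \<sigma> f g) \<le> hs_norm \<tau> f * hs_norm \<tau> g"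
  unfolding hs_inner_eq_suminf hs_norm_eq[OF assms(1)] hs_norm_eq[OF assms(2)]
  by (rule square_summable_inner(2)[OF assms[THEN hs_space_square_summable]])

text \<open>The common membership test for basis functions, kernels, finite sums and images under
  the adjoint: exhibit a power series in \<open>\<psi> w\<close> with square-summable
  coefficients.\<close>

lemma in_hs_spaceI:
  assumes "\<And>w. w \<in> \<Omega> \<Longrightarrow> (\<lambda>n. x n * \<psi> w ^ n) sums (f w * \<sigma> (\<psi> w))" "square_summable x"
  shows "f \<in> hs_space \<Omega> \<tau>" "hs_coeff f = x"
proof -
  show "hs_coeff f = x"
    by (rule ext, rule hs_coeff_unique, rule assms)
  then show "f \<in> hs_space \<Omega> \<tau>"
    using holomorphic_if_hs_coeff_sums[OF assms(1)] assms(2) by (simp add: hs_space_iff)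
qed

section \<open>Basis functions and reproducing kernel\<close>

lemma hs_coeff_basis_fun: "hs_coeff (basis_fun n) = (\<lambda>m. if m = n then 1 else 0)"
  and basis_fun_in: "basis_fun n \<in> hs_space \<Omega> \<tau>"
proof -
  let ?x = "\<lambda>m. if m = n then 1 else 0 :: complex"
  have sums: "(\<lambda>m. ?x m * \<psi> w ^ m) sums (basis_fun n w * \<sigma> (\<psi> w))" if "w \<in> \<Omega>" for w
  proof -
    have "(\<lambda>m. if m = n then \<psi> w ^ m else 0) sums (\<psi> w ^ n)"
      by (rule sums_single)
    moreover have "?x m * \<psi> w ^ m = (if m = n then \<psi> w ^ m else 0)" for m
      by simp
    moreover have "basis_fun n w * \<sigma> (\<psi> w) = \<psi> w ^ n"
      using that by (simp add: basis_fun_def \<sigma>_\<psi>_nonzero)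
    ultimately show ?thesis
      by (simp only:)
  qed
  have sq: "square_summable ?x"
    by (rule square_summable_finite_support(1)[of "Suc n"]) auto
  show "basis_fun n \<in> hs_space \<Omega> \<tau>"
    by (rule in_hs_spaceI(1)[OF sums sq])
  show "hs_coeff (basis_fun n) = ?x"
    by (rule in_hs_spaceI(2)[OF sums sq])
qed

text \<open>The geometric series in \<open>cnj (\<psi> v) * \<psi> w\<close> expands the kernel; its
  coefficients decay geometrically because \<open>\<psi> v\<close> lies inside the disc.\<close>

lemma
  assumes v: "v \<in> \<Omega>"
  shows hs_coeff_kernel: "hs_coeff (kernel v) = (\<lambda>n. cnj (basis_fun n v))"
    and kernel_in: "kernel v \<in> hs_space \<Omega> \<tau>"
proof -
  have sums: "(\<lambda>n. cnj (basis_fun n v) * \<psi> w ^ n) sums (kernel v w * \<sigma> (\<psi> w))" if w: "w \<in> \<Omega>" for w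
  proof -
    have "norm (\<psi> v) * norm (\<psi> w) < 1 * 1"
      by (rule mult_strict_mono') (use norm_\<psi> v w in auto)
    then have "norm (cnj (\<psi> v) * \<psi> w) < 1"
      by (simp add: norm_mult)
    from sums_mult[OF geometric_sums[OF this], of "1 / cnj (\<sigma> (\<psi> v))"]
    have "(\<lambda>n. 1 / cnj (\<sigma> (\<psi> v)) * (cnj (\<psi> v) * \<psi> w) ^ n) sums
        (1 / cnj (\<sigma> (\<psi> v)) * (1 / (1 - cnj (\<psi> v) * \<psi> w)))" .
    moreover have "1 / cnj (\<sigma> (\<psi> v)) * (1 / (1 - cnj (\<psi> v) * \<psi> w)) = kernel v w * \<sigma> (\<psi> w)"
      using \<sigma>_\<psi>_nonzero[OF w] by (simp add: kernel_def)
    moreover have "1 / cnj (\<sigma> (\<psi> v)) * (cnj (\<psi> v) * \<psi> w) ^ n = cnj (basis_fun n v) * \<psi> w ^ n" for n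
      by (simp add: basis_fun_def power_mult_distrib)
    ultimately show ?thesis
      by simp
  qed
  have sq: "square_summable (\<lambda>n. cnj (basis_fun n v))"
  proof -
    have "(norm (\<psi> v))\<^sup>2 < 1"
      using norm_\<psi>[OF v] by (simp add: abs_square_less_1)
    then have "summable (\<lambda>n. 1 / (norm (\<sigma> (\<psi> v)))\<^sup>2 * ((norm (\<psi> v))\<^sup>2) ^ n)"
      by (intro summable_mult summable_geometric) simp
    moreover have "(norm (cnj (basis_fun n v)))\<^sup>2 = 1 / (norm (\<sigma> (\<psi> v)))\<^sup>2 * ((norm (\<psi> v))\<^sup>2) ^ n" for n
    proof -
      have "(norm (\<psi> v) ^ n)\<^sup>2 = ((norm (\<psi> v))\<^sup>2) ^ n"
        by (simp only: power_mult[symmetric] mult.commute)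
      then show ?thesis
        by (simp add: basis_fun_def norm_divide norm_power power_divide)
    qed
    ultimately show ?thesis
      by (simp only: square_summable_def)
  qed
  show "kernel v \<in> hs_space \<Omega> \<tau>"
    by (rule in_hs_spaceI(1)[OF sums sq])
  show "hs_coeff (kernel v) = (\<lambda>n. cnj (basis_fun n v))"
    by (rule in_hs_spaceI(2)[OF sums sq])
qed

text \<open>The reproducing property: conjugating the kernel coefficients gives
  \<open>basis_fun n v\<close>, so the pairing is the expansion of \<open>f\<close> at
  \<open>v\<close>.\<close>

lemma hs_inner_kernel:
  assumes "f \<in> hs_space \<Omega> \<tau>" "v \<in> \<Omega>"
  shows "hs_inner \<tau> \<sigma> f (kernel v) = f v"
proof (rule sums_unique2)
  show "(\<lambda>n. hs_coeff f n * cnj (hs_coeff (kernel v) n)) sums hs_inner \<tau> \<sigma> f (kernel v)"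
    by (intro hs_inner_sums kernel_in assms)
  show "(\<lambda>n. hs_coeff f n * cnj (hs_coeff (kernel v) n)) sums f v"
    using sums_divide[OF hs_coeff_sums[OF hs_space_holomorphic[OF assms(1)] assms(2)], of "\<sigma> (\<psi> v)"] assms(2)
    by (simp add: hs_coeff_kernel basis_fun_def \<sigma>_\<psi>_nonzero)
qed

text \<open>Two basis functions suffice: the one of index 0 equates the values of
  \<open>\<sigma>\<close>, then the one of index 1 equates those of \<open>\<psi>\<close>, which is
  injective on \<open>\<Omega>\<close>.\<close>

lemma hs_space_separates_points:
  assumes "v \<in> \<Omega>" "w \<in> \<Omega>" "\<And>f. f \<in> hs_space \<Omega> \<tau> \<Longrightarrow> f v = f w"
  shows "v = w"
proof -
  have "\<psi> v = \<psi> w"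
    using assms(3)[OF basis_fun_in[of 0]] assms(3)[OF basis_fun_in[of 1]] assms(1,2)
    by (simp add: basis_fun_def \<sigma>_\<psi>_nonzero)
  then show ?thesis
    using assms(1,2) \<tau>_\<psi> by metis
qed

subsection \<open>Adjoints of bounded operators\<close>

lemma hs_bounded_op_in: "hs_bounded_op \<Omega> \<tau> T \<Longrightarrow> f \<in> hs_space \<Omega> \<tau> \<Longrightarrow> T f \<in> hs_space \<Omega> \<tau>"
  by (simp add: hs_bounded_op_def)

lemma hs_bounded_op_bound:
  assumes "hs_bounded_op \<Omega> \<tau> T"
  obtains K where "K \<ge> 0" "\<And>f. f \<in> hs_space \<Omega> \<tau> \<Longrightarrow> hs_norm \<tau> (T f) \<le> K * hs_norm \<tau> f"
proof -
  obtain K where K: "\<forall>f\<in>hs_space \<Omega> \<tau>. hs_norm \<tau> (T f) \<le> K * hs_norm \<tau> f"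
    using assms by (auto simp: hs_bounded_op_def)
  show ?thesis
  \<comment> \<open>The given constant may be negative; norms are nonnegative, so its absolute value
    still bounds.\<close>
  proof (rule that[of "\<bar>K\<bar>"])
    show "hs_norm \<tau> (T f) \<le> \<bar>K\<bar> * hs_norm \<tau> f" if "f \<in> hs_space \<Omega> \<tau>" for f
    proof -
      have "hs_norm \<tau> (T f) \<le> K * hs_norm \<tau> f"
        using K that by simp
      also have "\<dots> \<le> \<bar>K\<bar> * hs_norm \<tau> f"
        using hs_norm_nonneg[OF that] by (intro mult_right_mono) auto
      finally show ?thesis .
    qed
  qed simp
qed

lemma hs_inner_bounded_op_linear:
  assumes T: "hs_bounded_op \<Omega> \<tau> T"
    and f: "f \<in> hs_space \<Omega> \<tau>" and g: "g \<in> hs_space \<Omega> \<tau>" and h: "h \<in> hs_space \<Omega> \<tau>"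
  shows "hs_inner \<tau> \<sigma> (T (\<lambda>u. \<alpha> * f u + \<beta> * g u)) h
    = \<alpha> * hs_inner \<tau> \<sigma> (T f) h + \<beta> * hs_inner \<tau> \<sigma> (T g) h"
proof -
  have "hs_inner \<tau> \<sigma> (T (\<lambda>u. \<alpha> * f u + \<beta> * g u)) h = hs_inner \<tau> \<sigma> (\<lambda>u. \<alpha> * T f u + \<beta> * T g u) h"
    by (rule hs_inner_cong) (use T f g in \<open>simp_all add: hs_bounded_op_def\<close>)
  then show ?thesis
    using T f g h by (simp add: hs_inner_linear_left hs_bounded_op_in)
qed

text \<open>Continuity of the functional sending \<open>f\<close> to the pairing of
  \<open>T f\<close> with \<open>g\<close>: the remainders of the basis expansion tend to 0 in norm,
  so the functional is determined by its values on the basis.\<close>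

lemma hs_inner_bounded_op_sums:
  assumes T: "hs_bounded_op \<Omega> \<tau> T" and f: "f \<in> hs_space \<Omega> \<tau>" and g: "g \<in> hs_space \<Omega> \<tau>"
  shows "(\<lambda>n. hs_coeff f n * hs_inner \<tau> \<sigma> (T (basis_fun n)) g) sums hs_inner \<tau> \<sigma> (T f) g"
proof -
  define R where "R N = (\<lambda>u. f u - (\<Sum>n<N. hs_coeff f n * basis_fun n u))" for N
  let ?S = "\<lambda>N. \<Sum>n<N. hs_coeff f n * hs_inner \<tau> \<sigma> (T (basis_fun n)) g"
  have R_0: "R 0 = f"
    by (simp add: R_def)
  \<comment> \<open>The factors 1 and \<open>- hs_coeff f N\<close> give the recursion the two-term
    form in which linearity of \<open>T\<close> is stated, so each induction below peels off one
    basis function.\<close>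
  have R_Suc: "R (Suc N) = (\<lambda>u. 1 * R N u + (- hs_coeff f N) * basis_fun N u)" for N
    by (simp add: R_def fun_eq_iff)
  have R_in: "R N \<in> hs_space \<Omega> \<tau>" for N
  proof (induction N)
    case (Suc N)
    show ?case
      unfolding R_Suc by (rule hs_space_linear[OF Suc basis_fun_in])
  qed (simp add: R_0 f)
  have coeff_R: "hs_coeff (R N) = (\<lambda>m. if m < N then 0 else hs_coeff f m)" for N
  proof (induction N)
    case (Suc N)
    show ?case
      unfolding R_Suc hs_coeff_linear[OF R_in[THEN hs_space_holomorphic] basis_fun_in[THEN hs_space_holomorphic]]
      by (auto simp: Suc hs_coeff_basis_fun not_less_less_Suc_eq fun_eq_iff)
  qed (simp add: R_0)
  have inner_R: "hs_inner \<tau> \<sigma> (T (R N)) g = hs_inner \<tau> \<sigma> (T f) g - ?S N" for N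
  proof (induction N)
    case (Suc N)
    show ?case
      unfolding R_Suc hs_inner_bounded_op_linear[OF T R_in basis_fun_in g] by (simp add: Suc)
  qed (simp add: R_0)
  obtain K where K: "K \<ge> 0" "\<And>f. f \<in> hs_space \<Omega> \<tau> \<Longrightarrow> hs_norm \<tau> (T f) \<le> K * hs_norm \<tau> f"
    using hs_bounded_op_bound[OF T] by metis
  have "(\<lambda>N. hs_inner \<tau> \<sigma> (T (R N)) g) \<longlonglongrightarrow> 0"
  proof (rule Lim_null_comparison)
    have "norm (hs_inner \<tau> \<sigma> (T (R N)) g)
        \<le> K * l2_norm (\<lambda>m. if m < N then 0 else hs_coeff f m) * hs_norm \<tau> g" for N
    proof -
      have "norm (hs_inner \<tau> \<sigma> (T (R N)) g) \<le> hs_norm \<tau> (T (R N)) * hs_norm \<tau> g"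
        by (rule hs_cauchy_schwarz[OF hs_bounded_op_in[OF T R_in] g])
      also have "\<dots> \<le> K * hs_norm \<tau> (R N) * hs_norm \<tau> g"
        by (intro mult_right_mono K R_in hs_norm_nonneg g)
      finally show ?thesis
        by (simp add: hs_norm_eq[OF R_in] coeff_R)
    qed
    then show "\<forall>\<^sub>F N in sequentially. norm (hs_inner \<tau> \<sigma> (T (R N)) g)
        \<le> K * l2_norm (\<lambda>m. if m < N then 0 else hs_coeff f m) * hs_norm \<tau> g"
      by simp
    show "(\<lambda>N. K * l2_norm (\<lambda>m. if m < N then 0 else hs_coeff f m) * hs_norm \<tau> g) \<longlonglongrightarrow> 0"
      using l2_norm_tail[OF hs_space_square_summable[OF f]]
      by (intro tendsto_mult_left_zero tendsto_mult_right_zero)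
  qed
  from tendsto_diff[OF tendsto_const[of "hs_inner \<tau> \<sigma> (T f) g"] this] show ?thesis
    by (simp add: inner_R sums_def)
qed

lemma basis_fun_sum:
  shows "(\<lambda>w. \<Sum>n<N. x n * basis_fun n w) \<in> hs_space \<Omega> \<tau>"
    and "hs_coeff (\<lambda>w. \<Sum>n<N. x n * basis_fun n w) = (\<lambda>n. if n < N then x n else 0)"
proof -
  let ?x = "\<lambda>n. if n < N then x n else 0"
  have sums: "(\<lambda>n. ?x n * \<psi> w ^ n) sums ((\<Sum>n<N. x n * basis_fun n w) * \<sigma> (\<psi> w))"
    if "w \<in> \<Omega>" for w
  proof -
    have "(\<lambda>n. ?x n * \<psi> w ^ n) sums (\<Sum>n<N. ?x n * \<psi> w ^ n)"
      by (rule sums_finite) auto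
    then show ?thesis
      using that by (simp add: sum_distrib_right basis_fun_def \<sigma>_\<psi>_nonzero)
  qed
  have sq: "square_summable ?x"
    by (rule square_summable_finite_support(1)[of N]) auto
  show "(\<lambda>w. \<Sum>n<N. x n * basis_fun n w) \<in> hs_space \<Omega> \<tau>"
    by (rule in_hs_spaceI(1)[OF sums sq])
  show "hs_coeff (\<lambda>w. \<Sum>n<N. x n * basis_fun n w) = ?x"
    by (rule in_hs_spaceI(2)[OF sums sq])
qed

text \<open>Testing \<open>T\<close> on the partial sums \<open>\<Sum>n<N. h n * e n\<close> gives \<open>\<Sum>n<N. \<bar>h n\<bar>\<^sup>2\<close>, so that Cauchy-Schwarz bounds
  the \<open>\<ell>\<^sup>2\<close> norm of \<open>h\<close>; no Riesz representation is needed.\<close>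

lemma square_summable_inner_basis:
  assumes T: "hs_bounded_op \<Omega> \<tau> T" and g: "g \<in> hs_space \<Omega> \<tau>"
    and K: "K \<ge> 0" "\<And>f. f \<in> hs_space \<Omega> \<tau> \<Longrightarrow> hs_norm \<tau> (T f) \<le> K * hs_norm \<tau> f"
  defines "h \<equiv> \<lambda>n. hs_inner \<tau> \<sigma> g (T (basis_fun n))"
  shows "square_summable h" "l2_norm h \<le> K * hs_norm \<tau> g"
proof -
  have bound: "L2_set (\<lambda>n. norm (h n)) {..<N} \<le> K * hs_norm \<tau> g" for N
  proof -
    let ?L = "L2_set (\<lambda>n. norm (h n)) {..<N}"
    define P where "P = (\<lambda>w. \<Sum>n<N. h n * basis_fun n w)"
    have P: "P \<in> hs_space \<Omega> \<tau>" "hs_coeff P = (\<lambda>n. if n < N then h n else 0)"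
      unfolding P_def by (rule basis_fun_sum)+
    have "hs_norm \<tau> P = L2_set (\<lambda>n. norm (hs_coeff P n)) {..<N}"
      unfolding hs_norm_eq[OF P(1)] by (rule square_summable_finite_support(2)) (simp add: P)
    then have norm_P: "hs_norm \<tau> P = ?L"
      by (simp add: P L2_set_def)
    have cnj_h: "hs_inner \<tau> \<sigma> (T (basis_fun n)) g = cnj (h n)" for n
      unfolding h_def by (simp add: hs_inner_cnj hs_bounded_op_in[OF T] basis_fun_in g)
    have "(\<lambda>n. hs_coeff P n * cnj (h n)) sums hs_inner \<tau> \<sigma> (T P) g"
      using hs_inner_bounded_op_sums[OF T P(1) g] by (simp only: cnj_h)
    moreover have "(\<lambda>n. hs_coeff P n * cnj (h n)) sums (\<Sum>n<N. hs_coeff P n * cnj (h n))"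
      by (rule sums_finite) (auto simp: P)
    ultimately have "hs_inner \<tau> \<sigma> (T P) g = (\<Sum>n<N. hs_coeff P n * cnj (h n))"
      by (rule sums_unique2)
    also have "\<dots> = of_real (\<Sum>n<N. (norm (h n))\<^sup>2)"
      unfolding of_real_sum by (rule sum.cong[OF refl]) (simp only: P(2) lessThan_iff if_True complex_norm_square)
    also have "(\<Sum>n<N. (norm (h n))\<^sup>2) = ?L\<^sup>2"
      by (simp add: L2_set_def sum_nonneg)
    finally have "?L\<^sup>2 = norm (hs_inner \<tau> \<sigma> (T P) g)"
      by (simp add: norm_power)
    also have "\<dots> \<le> hs_norm \<tau> (T P) * hs_norm \<tau> g"
      by (rule hs_cauchy_schwarz[OF hs_bounded_op_in[OF T P(1)] g])
    also have "\<dots> \<le> K * hs_norm \<tau> P * hs_norm \<tau> g"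
      by (intro mult_right_mono K P hs_norm_nonneg g)
    finally have "?L * ?L \<le> ?L * (K * hs_norm \<tau> g)"
      by (simp add: norm_P power2_eq_square mult_ac)
    moreover have "?L \<ge> 0" "K * hs_norm \<tau> g \<ge> 0"
      by (simp_all add: L2_set_nonneg K hs_norm_nonneg g)
    \<comment> \<open>One factor \<open>?L\<close> is cancelled; if it is 0, the claim is just
      nonnegativity of the right-hand side.\<close>
    ultimately show ?thesis
      by (cases "?L = 0") (auto simp: mult_le_cancel_left)
  qed
  show "square_summable h"
    by (rule square_summableI_bounded(1)[OF bound])
  show "l2_norm h \<le> K * hs_norm \<tau> g"
    by (rule square_summableI_bounded(2)[OF bound])
qed

text \<open>The kernel at \<open>w\<close> is the sum of the basis functions weighted by
  \<open>cnj (basis_fun n w)\<close>. Applying \<open>T\<close> and pairing with \<open>g\<close>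
  therefore gives a series in \<open>basis_fun n w\<close>, whose coefficients are square-summable
  by the preceding bound.\<close>

lemma
  assumes T: "hs_bounded_op \<Omega> \<tau> T" and g: "g \<in> hs_space \<Omega> \<tau>"
  shows kernel_adjoint_in: "(\<lambda>w. hs_inner \<tau> \<sigma> g (T (kernel w))) \<in> hs_space \<Omega> \<tau>"
    and hs_coeff_kernel_adjoint:
      "hs_coeff (\<lambda>w. hs_inner \<tau> \<sigma> g (T (kernel w))) = (\<lambda>n. hs_inner \<tau> \<sigma> g (T (basis_fun n)))"
proof -
  let ?h = "\<lambda>n. hs_inner \<tau> \<sigma> g (T (basis_fun n))"
  have sums: "(\<lambda>n. ?h n * \<psi> w ^ n) sums (hs_inner \<tau> \<sigma> g (T (kernel w)) * \<sigma> (\<psi> w))"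
    if w: "w \<in> \<Omega>" for w
  proof -
    have "(\<lambda>n. basis_fun n w * ?h n) sums hs_inner \<tau> \<sigma> g (T (kernel w))"
      using iffD2[OF sums_cnj hs_inner_bounded_op_sums[OF T kernel_in[OF w] g]] w
      by (simp add: hs_coeff_kernel hs_inner_cnj hs_bounded_op_in[OF T] basis_fun_in kernel_in g)
    from sums_mult2[OF this, of "\<sigma> (\<psi> w)"] show ?thesis
      using w by (simp add: basis_fun_def \<sigma>_\<psi>_nonzero mult_ac)
  qed
  obtain K where "K \<ge> 0" "\<And>f. f \<in> hs_space \<Omega> \<tau> \<Longrightarrow> hs_norm \<tau> (T f) \<le> K * hs_norm \<tau> f"
    using hs_bounded_op_bound[OF T] by metis
  then have sq: "square_summable ?h"
    by (rule square_summable_inner_basis(1)[OF T g])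
  show "(\<lambda>w. hs_inner \<tau> \<sigma> g (T (kernel w))) \<in> hs_space \<Omega> \<tau>"
    by (rule in_hs_spaceI(1)[OF sums sq])
  show "hs_coeff (\<lambda>w. hs_inner \<tau> \<sigma> g (T (kernel w))) = ?h"
    by (rule in_hs_spaceI(2)[OF sums sq])
qed

text \<open>Existence of the adjoint by an explicit formula. Both sides of the adjoint identity
  expand into the same series over the basis, and the operator bound of \<open>T\<close> carries
  over with the same constant.\<close>

lemma hs_adjoint_kernel:
  assumes T: "hs_bounded_op \<Omega> \<tau> T"
  shows "hs_adjoint \<Omega> \<tau> \<sigma> T (\<lambda>g w. hs_inner \<tau> \<sigma> g (T (kernel w)))"
  unfolding hs_adjoint_def hs_bounded_op_def
proof (intro conjI ballI allI)
  show "(\<lambda>w. hs_inner \<tau> \<sigma> g (T (kernel w))) \<in> hs_space \<Omega> \<tau>" if "g \<in> hs_space \<Omega> \<tau>" for g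
    by (rule kernel_adjoint_in[OF T that])
  show "hs_inner \<tau> \<sigma> (\<lambda>u. \<alpha> * f u + \<beta> * g u) (T (kernel w))
      = \<alpha> * hs_inner \<tau> \<sigma> f (T (kernel w)) + \<beta> * hs_inner \<tau> \<sigma> g (T (kernel w))"
    if "f \<in> hs_space \<Omega> \<tau>" "g \<in> hs_space \<Omega> \<tau>" "w \<in> \<Omega>" for f g \<alpha> \<beta> w
    using that by (simp add: hs_inner_linear_left hs_bounded_op_in[OF T] kernel_in)
  show "hs_inner \<tau> \<sigma> (T f) g = hs_inner \<tau> \<sigma> f (\<lambda>w. hs_inner \<tau> \<sigma> g (T (kernel w)))"
    if f: "f \<in> hs_space \<Omega> \<tau>" and g: "g \<in> hs_space \<Omega> \<tau>" for f g
  proof (rule sums_unique2)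
    show "(\<lambda>n. hs_coeff f n * hs_inner \<tau> \<sigma> (T (basis_fun n)) g) sums hs_inner \<tau> \<sigma> (T f) g"
      by (rule hs_inner_bounded_op_sums[OF T f g])
    show "(\<lambda>n. hs_coeff f n * hs_inner \<tau> \<sigma> (T (basis_fun n)) g) sums
        hs_inner \<tau> \<sigma> f (\<lambda>w. hs_inner \<tau> \<sigma> g (T (kernel w)))"
      using hs_inner_sums[OF f kernel_adjoint_in[OF T g]]
      by (simp add: hs_coeff_kernel_adjoint[OF T g] hs_inner_cnj hs_bounded_op_in[OF T] basis_fun_in g)
  qed
  obtain K where K: "K \<ge> 0" "\<And>f. f \<in> hs_space \<Omega> \<tau> \<Longrightarrow> hs_norm \<tau> (T f) \<le> K * hs_norm \<tau> f"
    using hs_bounded_op_bound[OF T] by metis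
  show "\<exists>K. \<forall>g\<in>hs_space \<Omega> \<tau>. hs_norm \<tau> (\<lambda>w. hs_inner \<tau> \<sigma> g (T (kernel w))) \<le> K * hs_norm \<tau> g"
  proof (intro exI[of _ K] ballI)
    show "hs_norm \<tau> (\<lambda>w. hs_inner \<tau> \<sigma> g (T (kernel w))) \<le> K * hs_norm \<tau> g"
      if g: "g \<in> hs_space \<Omega> \<tau>" for g
      unfolding hs_norm_eq[OF kernel_adjoint_in[OF T g]] hs_coeff_kernel_adjoint[OF T g]
      using square_summable_inner_basis(2)[OF T g K] .
  qed
qed

text \<open>Uniqueness of the adjoint on \<open>\<Omega>\<close>: evaluation at \<open>w\<close> is
  pairing with the kernel, and the adjoint identity moves \<open>T\<close> onto that kernel.\<close>

lemma hs_adjoint_eq: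
  assumes T: "hs_bounded_op \<Omega> \<tau> T" and T': "hs_adjoint \<Omega> \<tau> \<sigma> T T'"
    and g: "g \<in> hs_space \<Omega> \<tau>" and w: "w \<in> \<Omega>"
  shows "T' g w = hs_inner \<tau> \<sigma> g (T (kernel w))"
proof -
  have T'g: "T' g \<in> hs_space \<Omega> \<tau>"
    using T' g by (simp add: hs_adjoint_def hs_bounded_op_in)
  have "T' g w = cnj (hs_inner \<tau> \<sigma> (kernel w) (T' g))"
    using T'g w by (simp add: hs_inner_kernel hs_inner_cnj kernel_in)
  also have "hs_inner \<tau> \<sigma> (kernel w) (T' g) = hs_inner \<tau> \<sigma> (T (kernel w)) g"
    using T' g w by (simp add: hs_adjoint_def kernel_in)
  finally show ?thesis
    using g w by (simp add: hs_inner_cnj hs_bounded_op_in[OF T] kernel_in)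
qed

section \<open>Normality of composition operators as commutation of symbols\<close>

text \<open>The kernel hypothesis says that composition with \<open>\<Phi>\<close> sends the kernel
  at \<open>w\<close> to \<open>cnj c\<close> times the kernel at \<open>\<Phi>' w\<close>. Hence
  the adjoint is \<open>c\<close> times composition with \<open>\<Phi>'\<close>. The factor
  \<open>c\<close> cancels from the commutation relation, and separation of points leaves an
  identity between the maps.\<close>

lemma hs_normal_comp_op_iff:
  assumes \<Phi>: "\<Phi> ` \<Omega> \<subseteq> \<Omega>" and \<Phi>': "\<Phi>' ` \<Omega> \<subseteq> \<Omega>" and bounded: "hs_bounded_op \<Omega> \<tau> (comp_op \<Phi>)"
    and c: "c \<noteq> 0"
    and kernel: "\<And>v w. v \<in> \<Omega> \<Longrightarrow> w \<in> \<Omega> \<Longrightarrow> kernel w (\<Phi> v) = cnj c * kernel (\<Phi>' w) v"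
  shows "hs_normal \<Omega> \<tau> \<sigma> (comp_op \<Phi>) \<longleftrightarrow> (\<forall>w\<in>\<Omega>. \<Phi>' (\<Phi> w) = \<Phi> (\<Phi>' w))"
proof -
  have in_\<Omega>: "\<Phi> w \<in> \<Omega>" "\<Phi>' w \<in> \<Omega>" if "w \<in> \<Omega>" for w
    using that \<Phi> \<Phi>' by auto
  have comp_in: "comp_op \<Phi> f \<in> hs_space \<Omega> \<tau>" if "f \<in> hs_space \<Omega> \<tau>" for f
    by (rule hs_bounded_op_in[OF bounded that])
  have adjoint: "T' g w = c * g (\<Phi>' w)"
    if T': "hs_adjoint \<Omega> \<tau> \<sigma> (comp_op \<Phi>) T'" and g: "g \<in> hs_space \<Omega> \<tau>" and w: "w \<in> \<Omega>" for T' g w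
  proof -
    have k: "kernel (\<Phi>' w) \<in> hs_space \<Omega> \<tau>"
      by (intro kernel_in in_\<Omega> w)
    have "hs_inner \<tau> \<sigma> (comp_op \<Phi> (kernel w)) g
        = hs_inner \<tau> \<sigma> (\<lambda>v. cnj c * kernel (\<Phi>' w) v + 0 * kernel (\<Phi>' w) v) g"
      by (rule hs_inner_cong) (simp_all add: comp_op_def kernel w)
    also have "\<dots> = cnj c * hs_inner \<tau> \<sigma> (kernel (\<Phi>' w)) g"
      unfolding hs_inner_linear_left[OF k k g] by simp
    finally have "cnj (hs_inner \<tau> \<sigma> (comp_op \<Phi> (kernel w)) g) = c * hs_inner \<tau> \<sigma> g (kernel (\<Phi>' w))"
      using hs_inner_cnj[OF k g] by simp
    then show ?thesis
      using hs_adjoint_eq[OF bounded T' g w] hs_inner_kernel[OF g in_\<Omega>(2)[OF w]]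
        hs_inner_cnj[OF comp_in[OF kernel_in[OF w]] g] by simp
  qed
  \<comment> \<open>Stated for an arbitrary adjoint: normality supplies some unknown one, while the
    converse direction uses the explicit one.\<close>
  have commute_iff: "(\<forall>f\<in>hs_space \<Omega> \<tau>. \<forall>w\<in>\<Omega>. comp_op \<Phi> (T' f) w = T' (comp_op \<Phi> f) w)
      \<longleftrightarrow> (\<forall>w\<in>\<Omega>. \<Phi>' (\<Phi> w) = \<Phi> (\<Phi>' w))"
    if T': "hs_adjoint \<Omega> \<tau> \<sigma> (comp_op \<Phi>) T'" for T'
  proof -
    have "comp_op \<Phi> (T' f) w = T' (comp_op \<Phi> f) w \<longleftrightarrow> f (\<Phi>' (\<Phi> w)) = f (\<Phi> (\<Phi>' w))"
      if "f \<in> hs_space \<Omega> \<tau>" "w \<in> \<Omega>" for f w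
      using adjoint[OF T' that(1) in_\<Omega>(1)[OF that(2)]] adjoint[OF T' comp_in[OF that(1)] that(2)] c
      by (simp add: comp_op_def)
    then show ?thesis
      using hs_space_separates_points in_\<Omega> by metis
  qed
  show ?thesis
    unfolding hs_normal_def using bounded commute_iff hs_adjoint_kernel[OF bounded] by blast
qed

end

section \<open>Linear fractional Riemann maps\<close>

lemma hardy_smirnov_linear_fractional:
  assumes "open \<Omega>" "linear_fractional_riemann_map a b c d \<tau> \<Omega>" "sqrt_deriv_branch \<tau> \<sigma>"
  shows "hardy_smirnov \<Omega> \<tau> \<sigma>"
  using assms by (simp add: hardy_smirnov_def linear_fractional_riemann_map_def)

text \<open>Division by zero yields 0, so the formula alone does not exclude a pole. Continuity of
  \<open>\<tau>\<close> does: letting \<open>u\<close> tend to \<open>z\<close> in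
  \<open>\<tau> u * (c * u + d) = a * u + b\<close> makes the numerator vanish at \<open>z\<close>
  as well, against the nonzero determinant.\<close>

lemma linear_fractional_denominator_nonzero:
  assumes "linear_fractional_riemann_map a b c d \<tau> \<Omega>" "norm z < 1"
  shows "c * z + d \<noteq> 0"
proof
  assume zero: "c * z + d = 0"
  have det: "a * d - b * c \<noteq> 0" and hol: "\<tau> holomorphic_on ball 0 1"
    and eq: "\<And>u. norm u < 1 \<Longrightarrow> \<tau> u = (a * u + b) / (c * u + d)"
    using assms by (simp_all add: linear_fractional_riemann_map_def riemann_map_def)
  have "c \<noteq> 0"
    using zero det by auto
  have "isCont \<tau> z"
    using continuous_on_interior[OF holomorphic_on_imp_continuous_on[OF hol], of z] assms(2) by simp
  then have "((\<lambda>u. \<tau> u * (c * u + d)) \<longlongrightarrow> \<tau> z * (c * z + d)) (at z)"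
    unfolding isCont_def by (intro tendsto_intros)
  moreover have "\<forall>\<^sub>F u in at z. \<tau> u * (c * u + d) = a * u + b"
  proof -
    have "\<forall>\<^sub>F u in at z. u \<in> ball 0 1 - {z}"
      using assms(2) by (intro eventually_at_in_open) auto
    then show ?thesis
    proof eventually_elim
      case (elim u)
      have "c * u + d = c * (u - z)"
        using zero by algebra
      then show ?case
        using elim \<open>c \<noteq> 0\<close> by (simp add: eq)
    qed
  qed
  ultimately have "((\<lambda>u. a * u + b) \<longlongrightarrow> \<tau> z * (c * z + d)) (at z)"
    by (rule Lim_transform_eventually)
  moreover have "((\<lambda>u. a * u + b) \<longlongrightarrow> a * z + b) (at z)"
    by (intro tendsto_intros)
  ultimately have "\<tau> z * (c * z + d) = a * z + b"
    by (rule LIM_unique)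
  then have "a * z + b = 0"
    using zero by simp
  then have "a * d - b * c = 0"
    using zero by algebra
  then show False
    using det by contradiction
qed

text \<open>Since \<open>\<tau>'\<close> is the determinant over \<open>(c * z + d)^2\<close>, the
  product \<open>\<sigma> z * (c * z + d)\<close> is a square root of the determinant at every
  point. A continuous function with two possible values on a connected set is constant.\<close>

lemma linear_fractional_sqrt_deriv:
  assumes \<tau>: "linear_fractional_riemann_map a b c d \<tau> \<Omega>" and \<sigma>: "sqrt_deriv_branch \<tau> \<sigma>"
  obtains \<kappa> where "\<kappa>\<^sup>2 = a * d - b * c" "\<And>z. norm z < 1 \<Longrightarrow> \<sigma> z * (c * z + d) = \<kappa>"
proof -
  let ?s = "\<lambda>z. \<sigma> z * (c * z + d)"
  have nonzero: "c * z + d \<noteq> 0" if "z \<in> ball 0 1" for z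
    using linear_fractional_denominator_nonzero[OF \<tau>] that by simp
  have square: "(?s z)\<^sup>2 = a * d - b * c" if z: "z \<in> ball 0 1" for z
  proof -
    have "((\<lambda>z. (a * z + b) / (c * z + d)) has_field_derivative (a * d - b * c) / (c * z + d)\<^sup>2) (at z)"
      using nonzero[OF z]
      by (auto intro!: derivative_eq_intros simp: power2_eq_square) (simp add: algebra_simps)
    then have "(\<tau> has_field_derivative (a * d - b * c) / (c * z + d)\<^sup>2) (at z)"
      by (rule has_field_derivative_transform_within_open[OF _ open_ball z])
        (use \<tau> in \<open>simp add: linear_fractional_riemann_map_def\<close>)
    then have "deriv \<tau> z = (a * d - b * c) / (c * z + d)\<^sup>2"
      by (rule DERIV_imp_deriv)
    moreover have "(\<sigma> z)\<^sup>2 = deriv \<tau> z"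
      using \<sigma> z by (simp add: sqrt_deriv_branch_def)
    ultimately show ?thesis
      using nonzero[OF z] by (simp add: power_mult_distrib)
  qed
  have "?s constant_on ball 0 1"
  proof (rule continuous_finite_range_constant)
    show "continuous_on (ball 0 1) ?s"
      using \<sigma> by (intro continuous_intros holomorphic_on_imp_continuous_on) (simp add: sqrt_deriv_branch_def)
    have "?s z \<in> {csqrt (a * d - b * c), - csqrt (a * d - b * c)}" if "z \<in> ball 0 1" for z
      using square[OF that] power2_eq_iff[of "?s z" "csqrt (a * d - b * c)"] by simp
    then have "?s ` ball 0 1 \<subseteq> {csqrt (a * d - b * c), - csqrt (a * d - b * c)}"
      by (rule image_subsetI)
    then show "finite (?s ` ball 0 1)"
      by (rule finite_subset) simp
  qed simp
  then obtain \<kappa> where \<kappa>: "\<forall>z\<in>ball 0 1. ?s z = \<kappa>"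
    unfolding constant_on_def by blast
  show ?thesis
  proof (rule that)
    show "\<kappa>\<^sup>2 = a * d - b * c"
      using square[of 0] \<kappa> by (metis centre_in_ball zero_less_one)
    show "\<sigma> z * (c * z + d) = \<kappa>" if "norm z < 1" for z
      using \<kappa> that by simp
  qed
qed

section \<open>Explicit kernel for linear fractional maps\<close>

text \<open>\<open>D\<close> is the expansion of \<open>(a - c * w) * cnj (a - c * v) - (b - d * w)
  * cnj (b - d * v)\<close>. For \<open>w = \<tau> q\<close>, \<open>a - c * w\<close> is the
  determinant over \<open>c * q + d\<close>, and \<open>d * w - b\<close> is \<open>q\<close> times
  that. So \<open>D\<close> is a multiple of \<open>1 - cnj p * q\<close>, the denominator of the
  Szego kernel.\<close>

lemma kernel_linear_fractional:
  assumes \<Omega>: "open \<Omega>" and \<tau>: "linear_fractional_riemann_map a b c d \<tau> \<Omega>"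
    and \<sigma>: "sqrt_deriv_branch \<tau> \<sigma>" and v: "v \<in> \<Omega>" and w: "w \<in> \<Omega>"
  defines "D \<equiv> of_real ((norm a)\<^sup>2 - (norm b)\<^sup>2) + w * (cnj b * d - cnj a * c)
      + cnj v * (b * cnj d - a * cnj c) + of_real ((norm c)\<^sup>2 - (norm d)\<^sup>2) * w * cnj v"
  shows "D \<noteq> 0" "hardy_smirnov.kernel \<tau> \<sigma> v w = of_real (norm (a * d - b * c)) / D"
proof -
  interpret hardy_smirnov \<Omega> \<tau> \<sigma>
    by (rule hardy_smirnov_linear_fractional[OF \<Omega> \<tau> \<sigma>])
  obtain \<kappa> where \<kappa>: "\<kappa>\<^sup>2 = a * d - b * c" "\<And>z. norm z < 1 \<Longrightarrow> \<sigma> z * (c * z + d) = \<kappa>"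
    by (rule linear_fractional_sqrt_deriv[OF \<tau> \<sigma>]) blast
  define p q where "p = \<psi> v" and "q = \<psi> w"
  have norm: "norm p < 1" "norm q < 1"
    using norm_\<psi> v w by (auto simp: p_def q_def)
  note nonzero = linear_fractional_denominator_nonzero[OF \<tau> norm(1)]
    linear_fractional_denominator_nonzero[OF \<tau> norm(2)]
  have det: "a * d - b * c \<noteq> 0"
    using \<tau> by (simp add: linear_fractional_riemann_map_def)
  have v_eq: "v = (a * p + b) / (c * p + d)" and w_eq: "w = (a * q + b) / (c * q + d)"
    using \<tau>_\<psi>[OF v] \<tau>_\<psi>[OF w] \<tau> norm by (simp_all add: linear_fractional_riemann_map_def flip: p_def q_def)
  have cross: "D * ((c * q + d) * cnj (c * p + d))
      = (a * d - b * c) * cnj (a * d - b * c) * (1 - cnj p * q)"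
  proof -
    let ?W = "c * q + d" and ?V = "cnj c * cnj p + cnj d"
    have w_mult: "w * ?W = a * q + b" and v_mult: "v * (c * p + d) = a * p + b"
      using nonzero by (simp_all add: v_eq w_eq)
    have v_mult': "cnj v * ?V = cnj a * cnj p + cnj b"
      using arg_cong[OF v_mult, of cnj] by simp
    \<comment> \<open>Grouped so that \<open>w\<close> and \<open>cnj v\<close> occur only in the
      products \<open>w * ?W\<close> and \<open>cnj v * ?V\<close>, which are polynomials in
      \<open>q\<close> and \<open>cnj p\<close>.\<close>
    have "D * (?W * ?V) = (a * cnj a - b * cnj b) * ?W * ?V + (w * ?W) * ?V * (cnj b * d - cnj a * c)
        + (cnj v * ?V) * ?W * (b * cnj d - a * cnj c)
        + (c * cnj c - d * cnj d) * (w * ?W) * (cnj v * ?V)"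
      unfolding D_def of_real_diff complex_norm_square by (simp only: algebra_simps)
    also have "\<dots> = (a * d - b * c) * (cnj a * cnj d - cnj b * cnj c) * (1 - cnj p * q)"
      unfolding w_mult v_mult' by (simp only: algebra_simps) simp
    finally show ?thesis
      by simp
  qed
  have "norm p * norm q < 1 * 1"
    by (rule mult_strict_mono') (use norm in auto)
  then have pq: "1 - cnj p * q \<noteq> 0"
    by (metis complex_mod_cnj eq_iff_diff_eq_0 less_irrefl mult_1 norm_mult norm_one)
  show D: "D \<noteq> 0"
  proof
    assume "D = 0"
    then have "(a * d - b * c) * cnj (a * d - b * c) * (1 - cnj p * q) = 0"
      using cross by (simp only: mult_zero_left)
    then show False
      using det pq by (simp only: mult_eq_0_iff complex_cnj_zero_iff simp_thms)
  qed
  have \<sigma>_eq: "\<sigma> p = \<kappa> / (c * p + d)" "\<sigma> q = \<kappa> / (c * q + d)"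
    using \<kappa>(2)[OF norm(1)] \<kappa>(2)[OF norm(2)] nonzero by (simp_all only: eq_divide_eq if_True simp_thms)
  have \<kappa>_nonzero: "\<kappa> \<noteq> 0"
    using \<kappa>(1) det by auto
  \<comment> \<open>Only \<open>cnj \<kappa> * \<kappa>\<close> enters the kernel, so both branches
    of the square root give the same one.\<close>
  have \<kappa>_norm: "of_real (norm (a * d - b * c)) = cnj \<kappa> * \<kappa>"
    unfolding \<kappa>(1)[symmetric] norm_power complex_norm_square by (rule mult.commute)
  have "(a * d - b * c) * cnj (a * d - b * c) = (cnj \<kappa> * \<kappa>)\<^sup>2"
    unfolding \<kappa>(1)[symmetric] complex_cnj_power power_mult_distrib by (rule mult.commute)
  with cross have cross': "D * ((c * q + d) * cnj (c * p + d)) = (cnj \<kappa> * \<kappa>)\<^sup>2 * (1 - cnj p * q)"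
    by (simp only:)
  have "kernel v w = (c * q + d) * cnj (c * p + d) / (cnj \<kappa> * \<kappa> * (1 - cnj p * q))"
    unfolding kernel_def p_def[symmetric] q_def[symmetric] \<sigma>_eq by simp
  also have "\<dots> = cnj \<kappa> * \<kappa> / D"
  proof -
    have nz: "cnj \<kappa> * \<kappa> * (1 - cnj p * q) \<noteq> 0"
      using \<kappa>_nonzero pq by (simp only: mult_eq_0_iff complex_cnj_zero_iff simp_thms)
    show ?thesis
      unfolding frac_eq_eq[OF nz D] using cross' by (simp only: power2_eq_square mult_ac)
  qed
  finally show "kernel v w = of_real (norm (a * d - b * c)) / D"
    by (simp only: \<kappa>_norm)
qed

section \<open>The two families of affine symbols\<close>

theorem proposition4p9:
  fixes \<Omega> :: "complex set" and \<tau> \<sigma> :: "complex \<Rightarrow> complex"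
    and a b c d l r :: complex
  assumes "open \<Omega>" and "simply_connected \<Omega>" and "\<Omega> \<noteq> UNIV"
    and "linear_fractional_riemann_map a b c d \<tau> \<Omega>"
    and "sqrt_deriv_branch \<tau> \<sigma>"
    and "l \<noteq> 0"
  shows
    "(let \<Phi> = (\<lambda>w. inverse (cnj l) * w + r);
          \<Phi>\<^sub>s = (\<lambda>w. l * w +
                 ((l - 1) * complex_of_real ((norm a)\<^sup>2 - (norm b)\<^sup>2) + l * cnj r * (b * cnj d - a * cnj c))
                   / (cnj b * d - cnj a * c))
      in (norm c)\<^sup>2 = (norm d)\<^sup>2 \<longrightarrow> \<Phi> ` \<Omega> \<subseteq> \<Omega> \<longrightarrow> \<Phi>\<^sub>s ` \<Omega> \<subseteq> \<Omega> \<longrightarrow>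
         hs_bounded_op \<Omega> \<tau> (comp_op \<Phi>) \<longrightarrow>
         (hs_normal \<Omega> \<tau> \<sigma> (comp_op \<Phi>) \<longleftrightarrow>
            (l - 1) * (1 - cnj l) * complex_of_real ((norm a)\<^sup>2 - (norm b)\<^sup>2)
              = complex_of_real (2 * Re (l * cnj r * (b * cnj d - a * cnj c) * (cnj l - 1)))))
     \<and>
     (let \<Phi> = (\<lambda>w. r * w +
                 (r - 1) * (b * cnj d - a * cnj c) / complex_of_real ((norm c)\<^sup>2 - (norm d)\<^sup>2));
          \<Phi>\<^sub>s = (\<lambda>w. cnj r * w +
                 (cnj r - 1) * (b * cnj d - a * cnj c) / complex_of_real ((norm c)\<^sup>2 - (norm d)\<^sup>2))
      in (norm c)\<^sup>2 \<noteq> (norm d)\<^sup>2 \<longrightarrow> \<Phi> ` \<Omega> \<subseteq> \<Omega> \<longrightarrow> \<Phi>\<^sub>s ` \<Omega> \<subseteq> \<Omega> \<longrightarrow>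
         hs_bounded_op \<Omega> \<tau> (comp_op \<Phi>) \<longrightarrow>
         hs_normal \<Omega> \<tau> \<sigma> (comp_op \<Phi>))"
proof -
  interpret hardy_smirnov \<Omega> \<tau> \<sigma>
    by (rule hardy_smirnov_linear_fractional[OF assms(1,4,5)])
  define A B E :: complex where "A = of_real ((norm a)\<^sup>2 - (norm b)\<^sup>2)"
    and "B = cnj b * d - cnj a * c" and "E = of_real ((norm c)\<^sup>2 - (norm d)\<^sup>2)"
  have cnj_A: "cnj A = A" and cnj_E: "cnj E = E" and cnj_B: "b * cnj d - a * cnj c = cnj B"
    by (simp_all add: A_def B_def E_def)
  have kernel_eq: "kernel v w = of_real (norm (a * d - b * c)) / (A + w * B + cnj v * cnj B + E * w * cnj v)"
    and nonzero: "A + w * B + cnj v * cnj B + E * w * cnj v \<noteq> 0" if "v \<in> \<Omega>" "w \<in> \<Omega>" for v w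
    using kernel_linear_fractional[OF assms(1,4,5) that] by (simp_all only: A_def B_def[symmetric] E_def cnj_B simp_thms)
  \<comment> \<open>Reduces a proportionality of kernels to one between their denominators. The
    scalar is nonzero because the denominators are.\<close>
  have kernel_transform: "kernel w x = cnj k * kernel y v"
    if "v \<in> \<Omega>" "w \<in> \<Omega>" "x \<in> \<Omega>" "y \<in> \<Omega>"
      and "A + v * B + cnj y * cnj B + E * v * cnj y
        = cnj k * (A + x * B + cnj w * cnj B + E * x * cnj w)" for v w x y k
  proof -
    have "cnj k \<noteq> 0"
      using nonzero[OF that(4,1)] that(5) by auto
    then show ?thesis
      unfolding kernel_eq[OF that(2,3)] kernel_eq[OF that(4,1)] that(5) by simp
  qed
  show ?thesis
    unfolding Let_def cnj_B A_def[symmetric] B_def[symmetric] E_def[symmetric]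
  proof (intro conjI impI)
    let ?\<Phi> = "\<lambda>w. inverse (cnj l) * w + r"
    let ?\<Phi>' = "\<lambda>w. l * w + ((l - 1) * A + l * cnj r * cnj B) / B"
    assume cd: "(norm c)\<^sup>2 = (norm d)\<^sup>2" and \<Phi>: "?\<Phi> ` \<Omega> \<subseteq> \<Omega>" and \<Phi>': "?\<Phi>' ` \<Omega> \<subseteq> \<Omega>"
      and bounded: "hs_bounded_op \<Omega> \<tau> (comp_op ?\<Phi>)"
    have E: "E = 0"
      using cd by (simp add: E_def)
    have "\<tau> 0 \<in> \<Omega>"
      by (rule \<tau>_in) simp
    \<comment> \<open>If \<open>B = 0\<close>, then \<open>|b| |d| = |a| |c|\<close>. As
      \<open>|c| = |d|\<close> is nonzero by the determinant condition, \<open>|a| = |b|\<close> and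
      so \<open>A = 0\<close>; with \<open>E = 0\<close> the kernel denominator would vanish
      identically.\<close>
    have B: "B \<noteq> 0"
    proof
      assume "B = 0"
      then have "norm b * norm d = norm a * norm c"
        by (simp add: B_def flip: norm_mult) (metis complex_mod_cnj norm_mult)
      moreover have "norm c = norm d"
        using cd by simp
      moreover have "norm d \<noteq> 0"
        using \<open>norm c = norm d\<close> assms(4) by (auto simp: linear_fractional_riemann_map_def)
      ultimately have "A = 0"
        by (simp add: A_def)
      then show False
        using nonzero[OF \<open>\<tau> 0 \<in> \<Omega>\<close> \<open>\<tau> 0 \<in> \<Omega>\<close>] \<open>B = 0\<close> E by simp
    qed
    have "hs_normal \<Omega> \<tau> \<sigma> (comp_op ?\<Phi>) \<longleftrightarrow> (\<forall>w\<in>\<Omega>. ?\<Phi>' (?\<Phi> w) = ?\<Phi> (?\<Phi>' w))"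
    \<comment> \<open>With \<open>E = 0\<close>, the factor \<open>cnj l\<close> restores the
      coefficient \<open>B\<close> of \<open>v\<close> in the denominator at
      \<open>?\<Phi> v\<close>; matching the remaining terms dictates the constant term of
      \<open>?\<Phi>'\<close>.\<close>
    proof (rule hs_normal_comp_op_iff[OF \<Phi> \<Phi>' bounded assms(6)])
      fix v w assume "v \<in> \<Omega>" "w \<in> \<Omega>"
      then show "kernel w (?\<Phi> v) = cnj l * kernel (?\<Phi>' w) v"
        using \<Phi> \<Phi>' assms(6) B
        by (intro kernel_transform) (auto simp: E cnj_A field_simps)
    qed
    also have "\<dots> \<longleftrightarrow> (l - 1) * (1 - cnj l) * A = cnj l * (l - 1) * r * B + l * cnj r * cnj B * (cnj l - 1)"
    proof -
      \<comment> \<open>Both compositions are affine with the same slope, so their difference does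
        not depend on \<open>w\<close> and one point of \<open>\<Omega>\<close> decides
        commutation.\<close>
      have "?\<Phi>' (?\<Phi> w) - ?\<Phi> (?\<Phi>' w)
          = (cnj l * (l - 1) * r * B + l * cnj r * cnj B * (cnj l - 1) - (l - 1) * (1 - cnj l) * A)
            / (cnj l * B)" for w
        using assms(6) B by (simp add: field_simps)
      then have "?\<Phi>' (?\<Phi> w) = ?\<Phi> (?\<Phi>' w) \<longleftrightarrow>
          (l - 1) * (1 - cnj l) * A = cnj l * (l - 1) * r * B + l * cnj r * cnj B * (cnj l - 1)" for w
        using assms(6) B by (metis complex_cnj_zero_iff divide_eq_0_iff eq_iff_diff_eq_0 mult_eq_0_iff)
      then show ?thesis
        using \<open>\<tau> 0 \<in> \<Omega>\<close> by blast
    qed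
    \<comment> \<open>The two summands are complex conjugates of each other.\<close>
    also have "cnj l * (l - 1) * r * B + l * cnj r * cnj B * (cnj l - 1)
        = of_real (2 * Re (l * cnj r * cnj B * (cnj l - 1)))"
      using complex_add_cnj[of "l * cnj r * cnj B * (cnj l - 1)"] by (simp add: algebra_simps)
    finally show "hs_normal \<Omega> \<tau> \<sigma> (comp_op ?\<Phi>) \<longleftrightarrow>
        (l - 1) * (1 - cnj l) * A = of_real (2 * Re (l * cnj r * cnj B * (cnj l - 1)))" .
  next
    let ?\<Phi> = "\<lambda>w. r * w + (r - 1) * cnj B / E"
    let ?\<Phi>' = "\<lambda>w. cnj r * w + (cnj r - 1) * cnj B / E"
    assume cd: "(norm c)\<^sup>2 \<noteq> (norm d)\<^sup>2" and \<Phi>: "?\<Phi> ` \<Omega> \<subseteq> \<Omega>" and \<Phi>': "?\<Phi>' ` \<Omega> \<subseteq> \<Omega>"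
      and bounded: "hs_bounded_op \<Omega> \<tau> (comp_op ?\<Phi>)"
    have E: "E \<noteq> 0"
      using cd by (simp add: E_def flip: of_real_power)
    have "hs_normal \<Omega> \<tau> \<sigma> (comp_op ?\<Phi>) \<longleftrightarrow> (\<forall>w\<in>\<Omega>. ?\<Phi>' (?\<Phi> w) = ?\<Phi> (?\<Phi>' w))"
    \<comment> \<open>Completing the product, the denominator is
      \<open>E * (w + cnj B / E) * (cnj v + B / E)\<close> plus a constant. \<open>?\<Phi>\<close>
      multiplies the first bracket by \<open>r\<close>, and so does \<open>?\<Phi>'\<close> the
      second after conjugation. The kernels therefore agree with factor 1.\<close>
    proof (rule hs_normal_comp_op_iff[OF \<Phi> \<Phi>' bounded one_neq_zero])
      fix v w assume "v \<in> \<Omega>" "w \<in> \<Omega>"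
      then show "kernel w (?\<Phi> v) = cnj 1 * kernel (?\<Phi>' w) v"
        using \<Phi> \<Phi>' E
        by (intro kernel_transform) (auto simp: cnj_E field_simps)
    qed
    moreover have "?\<Phi>' (?\<Phi> w) = ?\<Phi> (?\<Phi>' w)" for w
      using E by (simp add: field_simps)
    ultimately show "hs_normal \<Omega> \<tau> \<sigma> (comp_op ?\<Phi>)"
      by blast
  qed
qed

end
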